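(* Let $\beta>2$ and let $\alpha_N>0$ be such that $\alpha_N\downarrow 0$ as $N\to\infty$ ($N$ even). Consider the two-block spin model with Gibbs measure $\mu_{N,\alpha_N,\beta}$ on $\{-1,+1\}^N$ and block magnetization vector $m^N=(m_1,m_2)$. Write $m^{\pm}:=m^{\pm}(\beta/2)$. (1) If $\lim_{N\to\infty} N\alpha_N=\infty$, then the distribution of $m^N$ under $\mu_{N,\alpha_N,\beta}$ converges weakly, as $N\to\infty$, to $$\frac12\left(\delta_{(m^+,m^+)}+\delta_{(m^-,m^-)}\right).$$ (2) If $\lim_{N\to\infty} N\alpha_N=0$, then the distribution of $m^N$ under $\mu_{N,\alpha_N,\beta}$ converges weakly, as $N\to\infty$, to $$\frac14\left(\delta_{(m^+,m^+)}+\delta_{(m^+,m^-)}+\delta_{(m^-,m^+)}+\delta_{(m^-,m^-)}\right).$$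
   Context: Let $N$ be even, $B_1=\{1,\dots,N/2\}$, $B_2=\{N/2+1,\dots,N\}$. For $\sigma\in\{-1,+1\}^N$ put $$H_{N,\alpha_N,\beta}(\sigma)=-\frac{\beta}{2N}\Big(\sum_{i,j\in B_1}\sigma_i\sigma_j+\sum_{i,j\in B_2}\sigma_i\sigma_j\Big)-\alpha_N\sum_{i\in B_1}\sigma_i\sigma_{i+N/2}.$$ The Gibbs measure is $$\mu_{N,\alpha_N,\beta}(\sigma)=\frac{e^{-H_{N,\alpha_N,\beta}(\sigma)}}{\sum_{\sigma'\in\{-1,+1\}^N}e^{-H_{N,\alpha_N,\beta}(\sigma')}}.$$ The block magnetizations are $m_1=\frac2N\sum_{i\in B_1}\sigma_i$ and $m_2=\frac2N\sum_{i\in B_2}\sigma_i$, and $m^N=(m_1,m_2)$. For $\gamma>0$, $m^+(\gamma)$ denotes the largest solution $z$ of $z=\tanh(\gamma z)$, and $m^-(\gamma)=-m^+(\gamma)$. $\delta_x$ is the Dirac measure at $x$. *)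

theory Defs
  imports "HOL-Probability.Probability"
begin

section \<open>The two-block spin model\<close>

definition block1 :: "nat \<Rightarrow> nat set" where
  "block1 N = {1..N div 2}"

definition block2 :: "nat \<Rightarrow> nat set" where
  "block2 N = {N div 2 + 1..N}"

text \<open>Spins are real numbers, so that no coercion is needed in the Hamiltonian.
  Configurations are extensional (equal to \<^const>\<open>undefined\<close> off \<open>{1..N}\<close>),
  hence there are exactly \<open>2 ^ N\<close> of them.\<close>

definition configs :: "nat \<Rightarrow> (nat \<Rightarrow> real) set" where
  "configs N = (\<Pi>\<^sub>E i\<in>{1..N}. {-1, 1})"

definition hamiltonian :: "nat \<Rightarrow> real \<Rightarrow> real \<Rightarrow> (nat \<Rightarrow> real) \<Rightarrow> real" where
  "hamiltonian N \<alpha> \<beta> \<sigma> =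
     - (\<beta> / (2 * real N)) *
         ((\<Sum>i\<in>block1 N. \<Sum>j\<in>block1 N. \<sigma> i * \<sigma> j) + (\<Sum>i\<in>block2 N. \<Sum>j\<in>block2 N. \<sigma> i * \<sigma> j))
     - \<alpha> * (\<Sum>i\<in>block1 N. \<sigma> i * \<sigma> (i + N div 2))"

definition partition_function :: "nat \<Rightarrow> real \<Rightarrow> real \<Rightarrow> real" where
  "partition_function N \<alpha> \<beta> = (\<Sum>\<sigma>\<in>configs N. exp (- hamiltonian N \<alpha> \<beta> \<sigma>))"

definition gibbs :: "nat \<Rightarrow> real \<Rightarrow> real \<Rightarrow> (nat \<Rightarrow> real) measure" where
  "gibbs N \<alpha> \<beta> =
     point_measure (configs N)
       (\<lambda>\<sigma>. ennreal (exp (- hamiltonian N \<alpha> \<beta> \<sigma>) / partition_function N \<alpha> \<beta>))"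

definition block_magnetization :: "nat \<Rightarrow> (nat \<Rightarrow> real) \<Rightarrow> real \<times> real" where
  "block_magnetization N \<sigma> =
     (2 / real N * (\<Sum>i\<in>block1 N. \<sigma> i), 2 / real N * (\<Sum>i\<in>block2 N. \<sigma> i))"

definition magnetization_law :: "nat \<Rightarrow> real \<Rightarrow> real \<Rightarrow> (real \<times> real) measure" where
  "magnetization_law N \<alpha> \<beta> = distr (gibbs N \<alpha> \<beta>) borel (block_magnetization N)"

definition m_plus :: "real \<Rightarrow> real" where
  "m_plus \<gamma> = (GREATEST z. z = tanh (\<gamma> * z))"

definition m_minus :: "real \<Rightarrow> real" where
  "m_minus \<gamma> = - m_plus \<gamma>"

section \<open>Weak convergence and sums of measures\<close>

text \<open>The library's \<^const>\<open>weak_conv_m\<close> is phrased with distribution functions and is limited to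
  sequences of measures on the real line.\<close>

definition weakly_converges ::
    "('i \<Rightarrow> 'a::topological_space measure) \<Rightarrow> 'a measure \<Rightarrow> 'i filter \<Rightarrow> bool" where
  "weakly_converges M L F \<longleftrightarrow>
     (\<forall>f :: 'a \<Rightarrow> real. continuous_on UNIV f \<longrightarrow> bounded (range f) \<longrightarrow>
        ((\<lambda>i. \<integral>x. f x \<partial>M i) \<longlongrightarrow> (\<integral>x. f x \<partial>L)) F)"

text \<open>Meaningful only for measures with the same space and the same measurable sets.\<close>

definition add_measure :: "'a measure \<Rightarrow> 'a measure \<Rightarrow> 'a measure" (infixl \<open>+\<^sub>M\<close> 65) where
  "M +\<^sub>M M' = measure_of (space M) (sets M) (\<lambda>A. emeasure M A + emeasure M' A)"

abbreviation dirac :: "'a::topological_space \<Rightarrow> 'a measure" where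
  "dirac x \<equiv> return borel x"

text \<open>The limit \<open>N \<rightarrow> \<infinity>\<close> along even \<open>N\<close>.\<close>

definition even_at_top :: "nat filter" where
  "even_at_top = inf at_top (principal {N. even N})"

section \<open>Well-definedness\<close>

lemma sets_add_measure [simp, measurable_cong]: "sets (M +\<^sub>M M') = sets M"
  by (simp add: add_measure_def)

lemma space_add_measure [simp]: "space (M +\<^sub>M M') = space M"
  by (simp add: add_measure_def)

lemma emeasure_add_measure:
  assumes "sets M = sets M'" and "A \<in> sets M"
  shows "emeasure (M +\<^sub>M M') A = emeasure M A + emeasure M' A"
proof (rule emeasure_measure_of[OF add_measure_def])
  show "sets M \<subseteq> Pow (space M)" by (rule sets.space_closed)
  show "A \<in> sets (M +\<^sub>M M')" using assms(2) by simp
  show "positive (sets (M +\<^sub>M M')) (\<lambda>A. emeasure M A + emeasure M' A)"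
    by (simp add: positive_def)
  show "countably_additive (sets (M +\<^sub>M M')) (\<lambda>A. emeasure M A + emeasure M' A)"
  proof (rule countably_additiveI)
    fix B :: "nat \<Rightarrow> 'a set"
    assume B: "range B \<subseteq> sets (M +\<^sub>M M')" "disjoint_family B"
    have 1: "(\<Sum>i. emeasure M (B i)) = emeasure M (\<Union>i. B i)"
      using B by (intro suminf_emeasure) auto
    have 2: "(\<Sum>i. emeasure M' (B i)) = emeasure M' (\<Union>i. B i)"
      using B assms(1) by (intro suminf_emeasure) auto
    show "(\<Sum>i. emeasure M (B i) + emeasure M' (B i)) =
        emeasure M (\<Union>i. B i) + emeasure M' (\<Union>i. B i)"
      by (simp add: suminf_add[symmetric] 1 2)
  qed
qed

lemma finite_configs: "finite (configs N)"
  by (auto simp: configs_def intro!: finite_PiE)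

lemma configs_nonempty: "configs N \<noteq> {}"
  by (auto simp: configs_def PiE_eq_empty_iff)

lemma partition_function_pos: "0 < partition_function N \<alpha> \<beta>"
  unfolding partition_function_def
  by (intro sum_pos finite_configs configs_nonempty) simp

lemma prob_space_gibbs: "prob_space (gibbs N \<alpha> \<beta>)"
proof (rule prob_spaceI)
  have "emeasure (gibbs N \<alpha> \<beta>) (space (gibbs N \<alpha> \<beta>)) =
      (\<Sum>\<sigma>\<in>configs N. ennreal (exp (- hamiltonian N \<alpha> \<beta> \<sigma>) / partition_function N \<alpha> \<beta>))"
    by (simp add: gibbs_def space_point_measure emeasure_point_measure_finite finite_configs)
  also have "\<dots> = ennreal ((\<Sum>\<sigma>\<in>configs N. exp (- hamiltonian N \<alpha> \<beta> \<sigma>)) / partition_function N \<alpha> \<beta>)"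
    using partition_function_pos[of N \<alpha> \<beta>]
    by (simp add: sum_divide_distrib)
  also have "\<dots> = 1"
    using partition_function_pos[of N \<alpha> \<beta>] by (simp add: partition_function_def[symmetric])
  finally show "emeasure (gibbs N \<alpha> \<beta>) (space (gibbs N \<alpha> \<beta>)) = 1" .
qed

lemma measurable_block_magnetization [measurable]:
  "block_magnetization N \<in> borel_measurable (gibbs N \<alpha> \<beta>)"
  by (simp add: gibbs_def)

lemma prob_space_magnetization_law: "prob_space (magnetization_law N \<alpha> \<beta>)"
  unfolding magnetization_law_def
  by (intro prob_space.prob_space_distr prob_space_gibbs measurable_block_magnetization)

lemma m_plus_greatest:
  shows "m_plus \<gamma> = tanh (\<gamma> * m_plus \<gamma>)"
    and "z = tanh (\<gamma> * z) \<Longrightarrow> z \<le> m_plus \<gamma>"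
proof -
  let ?S = "{z :: real. z = tanh (\<gamma> * z)}"
  have "?S \<subseteq> {-1..1}"
  proof
    fix z assume "z \<in> ?S"
    then have "z = tanh (\<gamma> * z)" by simp
    moreover have "-1 < tanh (\<gamma> * z)" "tanh (\<gamma> * z) < 1"
      by (rule tanh_real_gt_neg1, rule tanh_real_lt_1)
    ultimately show "z \<in> {-1..1}" by auto
  qed
  moreover have "closed ?S"
    by (intro closed_Collect_eq continuous_intros) (simp_all add: less_imp_neq)
  ultimately have "compact ?S"
    by (meson bounded_closed_interval bounded_subset compact_eq_bounded_closed)
  moreover have "?S \<noteq> {}"
    by (rule ex_in_conv[THEN iffD1], rule exI[of _ 0]) simp
  ultimately obtain m where "m \<in> ?S" "\<forall>z\<in>?S. z \<le> m"
    using compact_attains_sup by blast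
  then have "m = tanh (\<gamma> * m)" "\<And>z. z = tanh (\<gamma> * z) \<Longrightarrow> z \<le> m" by auto
  then show "m_plus \<gamma> = tanh (\<gamma> * m_plus \<gamma>)" and "z = tanh (\<gamma> * z) \<Longrightarrow> z \<le> m_plus \<gamma>"
    unfolding m_plus_def
    by (metis (mono_tags, lifting) GreatestI2_order, metis (mono_tags, lifting) Greatest_equality)
qed

end

theory Submission
  imports Defs
begin

text \<open>
  Write \<open>N = 2 n\<close> and \<open>\<gamma> = \<beta> / 2 > 1\<close>. In terms of the block magnetizations
  \<open>m = (m\<^sub>1, m\<^sub>2)\<close> and the overlap \<open>X = (\<Sum>i\<le>n. \<sigma> i * \<sigma> (i + n))\<close> a configuration has weight
  \<open>exp (n \<gamma> |m|\<^sup>2 / 2 + \<alpha> X)\<close>: two Curie--Weiss models coupled by \<open>X\<close>, where \<open>|\<alpha> X| \<le> \<alpha> n = o(n)\<close>.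

  Completing the square, \<open>|m|\<^sup>2 / 2 = y \<bullet> m - |y|\<^sup>2 / 2 + |m - y|\<^sup>2 / 2\<close>, turns the weight into a linearized
  weight, whose exponent is linear in \<open>m\<close> and \<open>X\<close>, times a factor that is at least one, and equal to one when
  \<open>m = y\<close>. The sum of the linearized weights over all configurations factorizes over the pairs
  \<open>(i, i + n)\<close> and is an explicit \<open>n\<close>-th power (lemma \<open>sum_exp_linearized\<close>). With \<open>\<alpha> = 0\<close> its base is
  \<open>\<psi> y\<^sub>1 * \<psi> y\<^sub>2\<close>, where \<open>\<psi> y = 2 cosh (\<gamma> y) exp (- \<gamma> y\<^sup>2 / 2)\<close>. This gives at once the lower bound
  \<open>(\<psi> y\<^sub>1 * \<psi> y\<^sub>2) ^ n\<close> for the partition function, for every \<open>y\<close>, and the same expression as an upper bound for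
  the part of the partition function with \<open>m = y\<close>. As \<open>m\<close> takes at most \<open>(2 n + 1)\<^sup>2\<close> values and \<open>\<psi>\<close> is
  maximal exactly at \<open>m\<^sup>+\<close> and \<open>m\<^sup>-\<close>, all mass outside a neighbourhood of the four corners \<open>(m\<^sup>\<plusminus>, m\<^sup>\<plusminus>)\<close> is
  exponentially small; the coupling changes weights only by a factor \<open>exp (o(n))\<close> and cannot destroy this
  (lemma \<open>restricted_partition_far_le\<close>).

  It remains to divide the mass among the corners. The global spin flip exchanges opposite corners. The
  flip of the second block carries \<open>(m\<^sup>+, m\<^sup>-)\<close> to \<open>(m\<^sup>+, m\<^sup>+)\<close> and changes the sign of \<open>\<alpha>\<close>, so everything
  depends on how the mass near \<open>(m\<^sup>+, m\<^sup>+)\<close> reacts to a change from \<open>\<alpha>\<close> to \<open>- \<alpha>\<close>. If \<open>n \<alpha> \<rightarrow> 0\<close>, all weights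
  change by a factor tending to one, so the four corners have asymptotically equal mass. If \<open>n \<alpha> \<rightarrow> \<infinity>\<close>, the
  mass near \<open>(m\<^sup>+, m\<^sup>+)\<close> under the coupling \<open>- \<alpha>\<close> is negligible: when both blocks are positively
  magnetized the overlap is at least \<open>c n\<close> except on a set of exponentially small weight, which the same product formula yields with \<open>\<alpha>\<close> replaced by a fixed
  negative number (lemma \<open>restricted_partition_antiferromagnetic_le\<close>). Convergence of the masses of small
  balls around finitely many points gives weak convergence
  (lemma \<open>weakly_converges_finite_support\<close>).
\<close>

section \<open>The mean-field equation and the weight of a single spin\<close>

text \<open>The function \<open>g y = tanh (\<gamma> * y) - y\<close> vanishes at \<open>0\<close> and, on the positive half line, has a strictly decreasing
  derivative that starts at \<open>\<gamma> - 1 > 0\<close>. Hence \<open>g\<close> first increases and then decreases, so it changes sign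
  exactly once, at its largest zero.\<close>

lemma mean_field_equation_unimodal:
  fixes \<gamma> :: real
  assumes "\<gamma> > 1"
  shows "m_plus \<gamma> > 0"
    and "\<And>y. 0 < y \<Longrightarrow> y < m_plus \<gamma> \<Longrightarrow> y < tanh (\<gamma> * y)"
    and "\<And>y. m_plus \<gamma> < y \<Longrightarrow> tanh (\<gamma> * y) < y"
proof -
  let ?g = "\<lambda>y. tanh (\<gamma> * y) - y"
  let ?g' = "\<lambda>y. \<gamma> * (1 - (tanh (\<gamma> * y))\<^sup>2) - 1"
  have der: "(?g has_real_derivative ?g' y) (at y)" for y
    by (auto intro!: derivative_eq_intros simp: cosh_real_nonzero)
  have anti: "?g' z < ?g' y" if "0 \<le> y" "y < z" for y z
  proof -
    have "0 \<le> tanh (\<gamma> * y)" "tanh (\<gamma> * y) < tanh (\<gamma> * z)" using that assms by auto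
    then have "(tanh (\<gamma> * y))\<^sup>2 < (tanh (\<gamma> * z))\<^sup>2" by (intro power_strict_mono) auto
    then show ?thesis using assms by simp
  qed
  have "\<exists>d>0. \<forall>h>0. h < d \<longrightarrow> ?g 0 < ?g (0 + h)"
    using der[of 0] assms by (intro DERIV_pos_inc_right) auto
  then obtain d where d: "d > 0" "\<And>h. 0 < h \<Longrightarrow> h < d \<Longrightarrow> ?g h > 0" by auto
  define h where "h = min (d / 2) (1/2)"
  have h: "0 < h" "h < 1" "?g h > 0" using d by (auto simp: h_def min_def)
  have "?g 1 \<le> 0" using tanh_real_lt_1[of \<gamma>] by simp
  have "\<exists>z. h \<le> z \<and> z \<le> 1 \<and> ?g z = 0"
    using h \<open>?g 1 \<le> 0\<close> by (intro IVT2) (auto intro!: continuous_intros simp: cosh_real_nonzero)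
  then obtain z where z: "h \<le> z" "z = tanh (\<gamma> * z)" by auto
  let ?m = "m_plus \<gamma>"
  show "?m > 0" using m_plus_greatest(2)[OF z(2)] z(1) h(1) by linarith
  have gm: "?g ?m = 0" using m_plus_greatest(1)[of \<gamma>] by simp
  \<comment> \<open>The critical point \<open>\<xi>\<close> separates the increasing from the decreasing part of \<open>g\<close>.\<close>
  obtain \<xi> where \<xi>: "0 < \<xi>" "\<xi> < ?m" "?g ?m - ?g 0 = (?m - 0) * ?g' \<xi>"
    using MVT2[OF \<open>?m > 0\<close>, of ?g ?g'] der by blast
  have \<xi>0: "?g' \<xi> = 0" using \<xi>(3) gm \<open>?m > 0\<close> by simp
  have inc: "?g 0 < ?g y" if "0 < y" "y \<le> \<xi>" for y
  proof (rule DERIV_pos_imp_increasing_open[OF that(1)])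
    show "\<exists>D. (?g has_real_derivative D) (at x) \<and> 0 < D" if "0 < x" "x < y" for x
      using der[of x] anti[of x \<xi>] \<xi>0 that \<open>y \<le> \<xi>\<close> by (intro exI[of _ "?g' x"]) linarith
    show "continuous_on {0..y} ?g" by (auto intro!: continuous_intros simp: cosh_real_nonzero)
  qed
  have dec: "?g z < ?g y" if "\<xi> \<le> y" "y < z" for y z
  proof (rule DERIV_neg_imp_decreasing_open[OF that(2)])
    show "\<exists>D. (?g has_real_derivative D) (at x) \<and> D < 0" if "y < x" "x < z" for x
      using der[of x] anti[of \<xi> x] \<xi>(1) \<xi>0 \<open>\<xi> \<le> y\<close> that by (intro exI[of _ "?g' x"]) linarith
    show "continuous_on {y..z} ?g" by (auto intro!: continuous_intros simp: cosh_real_nonzero)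
  qed
  show "y < tanh (\<gamma> * y)" if "0 < y" "y < ?m" for y
    using inc[of y] dec[of y ?m] gm that by (cases "y \<le> \<xi>") auto
  show "tanh (\<gamma> * y) < y" if "?m < y" for y
    using dec[of ?m y] gm that \<xi> by auto
qed

text \<open>The sum over one spin \<open>s = \<plusminus>1\<close> of \<open>exp (\<gamma> * y * s - \<gamma> * y\<^sup>2 / 2)\<close>, that is, the exponential of the Curie--Weiss
  free energy functional at magnetization \<open>y\<close>.\<close>

definition site_weight :: "real \<Rightarrow> real \<Rightarrow> real" where
  "site_weight \<gamma> y = 2 * cosh (\<gamma> * y) * exp (- (\<gamma> / 2 * y\<^sup>2))"

lemma site_weight_pos: "0 < site_weight \<gamma> y"
  by (simp add: site_weight_def)

lemma site_weight_minus: "site_weight \<gamma> (- y) = site_weight \<gamma> y"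
  by (simp add: site_weight_def)

lemma continuous_on_site_weight [continuous_intros]:
  "continuous_on A f \<Longrightarrow> continuous_on A (\<lambda>x. site_weight \<gamma> (f x))"
  unfolding site_weight_def by (intro continuous_intros)

text \<open>The logarithmic derivative of the site weight is \<open>\<gamma> * (tanh (\<gamma> * y) - y)\<close>, so the sign change in the mean-field
  equation is the only maximum on the positive half line; the weight is even.\<close>

lemma site_weight_less_max:
  assumes "\<gamma> > 1" and "\<bar>y\<bar> \<noteq> m_plus \<gamma>"
  shows "site_weight \<gamma> y < site_weight \<gamma> (m_plus \<gamma>)"
proof -
  note m = mean_field_equation_unimodal[OF \<open>\<gamma> > 1\<close>]
  have der: "(site_weight \<gamma> has_real_derivative \<gamma> * site_weight \<gamma> x * (tanh (\<gamma> * x) - x)) (at x)" for x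
    unfolding site_weight_def
    by (auto intro!: derivative_eq_intros simp: tanh_def field_simps)
  have pos: "\<gamma> * site_weight \<gamma> x > 0" for x using assms site_weight_pos[of \<gamma> x] by simp
  have cont: "continuous_on A (site_weight \<gamma>)" for A
    by (intro continuous_on_site_weight[of A "\<lambda>x. x"] continuous_intros)
  have "site_weight \<gamma> x < site_weight \<gamma> (m_plus \<gamma>)" if "0 \<le> x" "x \<noteq> m_plus \<gamma>" for x
  proof (cases "x < m_plus \<gamma>")
    case True
    show ?thesis
    proof (rule DERIV_pos_imp_increasing_open[OF True _ cont])
      fix u assume "x < u" "u < m_plus \<gamma>"
      then show "\<exists>D. (site_weight \<gamma> has_real_derivative D) (at u) \<and> 0 < D"
        using der[of u] pos[of u] m(2)[of u] that by (intro exI conjI) (assumption, auto)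
    qed
  next
    case False
    then have "m_plus \<gamma> < x" using that by simp
    then show ?thesis
    proof (rule DERIV_neg_imp_decreasing_open[OF _ _ cont])
      fix u assume "m_plus \<gamma> < u" "u < x"
      then show "\<exists>D. (site_weight \<gamma> has_real_derivative D) (at u) \<and> D < 0"
        using der[of u] pos[of u] m(3)[of u] that
        by (intro exI conjI) (assumption, auto intro: mult_pos_neg)
    qed
  qed
  from this[of "\<bar>y\<bar>"] show ?thesis
    using assms(2) site_weight_minus[of \<gamma> y] by (auto simp: abs_if split: if_splits)
qed

text \<open>The function has value one and slope \<open>- t\<close> at \<open>\<theta> = 0\<close>.\<close>

lemma cosh_minus_sinh_less_one:
  fixes t :: real
  assumes "0 < t" "t < 1"
  obtains \<theta> :: real where "\<theta> > 0" "cosh \<theta> - t * sinh \<theta> < 1"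
proof -
  have "((\<lambda>\<theta>. cosh \<theta> - t * sinh \<theta>) has_real_derivative - t) (at 0)"
    by (auto intro!: derivative_eq_intros)
  then have "\<exists>d>0. \<forall>h>0. h < d \<longrightarrow> cosh (0 + h) - t * sinh (0 + h) < cosh 0 - t * sinh 0"
    using assms by (intro DERIV_neg_dec_right) auto
  then obtain d where "d > 0" "\<And>h. 0 < h \<Longrightarrow> h < d \<Longrightarrow> cosh h - t * sinh h < 1" by auto
  then show ?thesis by (intro that[of "d / 2"]) auto
qed

section \<open>Linearized weights factorize over pairs of spins\<close>

definition overlap :: "nat \<Rightarrow> (nat \<Rightarrow> real) \<Rightarrow> real" where
  "overlap N \<sigma> = (\<Sum>i\<in>block1 N. \<sigma> i * \<sigma> (i + N div 2))"

text \<open>A configuration on two blocks of size \<open>n\<close> is the same as a family of \<open>n\<close> independent pairs of spins.\<close>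

lemma sum_configs_prod_pairs:
  fixes f :: "real \<Rightarrow> real \<Rightarrow> real"
  shows "(\<Sum>\<sigma>\<in>configs (2 * n). \<Prod>i\<in>{1..n}. f (\<sigma> i) (\<sigma> (i + n)))
    = (\<Sum>s\<in>{-1, 1}. \<Sum>t\<in>{-1, 1}. f s t) ^ n"
proof -
  let ?P = "\<Pi>\<^sub>E i\<in>{1..n}. {-1, 1 :: real} \<times> {-1, 1 :: real}"
  let ?join = "\<lambda>g. restrict (\<lambda>j. if j \<le> n then fst (g j) else snd (g (j - n))) {1..2 * n}"
  let ?split = "\<lambda>\<sigma>. restrict (\<lambda>i. (\<sigma> i, \<sigma> (i + n))) {1..n}"
  have "(\<Sum>\<sigma>\<in>configs (2 * n). \<Prod>i\<in>{1..n}. f (\<sigma> i) (\<sigma> (i + n)))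
      = (\<Sum>g\<in>?P. \<Prod>i\<in>{1..n}. case_prod f (g i))"
  proof (rule sum.reindex_bij_witness[where i = ?join and j = ?split])
    fix \<sigma> assume \<sigma>: "\<sigma> \<in> configs (2 * n)"
    show "?join (?split \<sigma>) = \<sigma>"
    proof
      fix j show "?join (?split \<sigma>) j = \<sigma> j"
      proof (cases "j \<in> {1..2 * n}")
        case True
        then show ?thesis by (cases "j \<le> n") auto
      next
        case False
        then have "\<sigma> j = undefined"
          using \<sigma> unfolding configs_def by (rule PiE_arb[rotated])
        then show ?thesis using False by simp
      qed
    qed
    have mem: "\<sigma> j \<in> {-1, 1}" if "j \<in> {1..2 * n}" for j
      using \<sigma> that unfolding configs_def by (rule PiE_mem)
    show "?split \<sigma> \<in> ?P"
      by (rule restrict_PiE_iff[THEN iffD2], intro ballI SigmaI mem) auto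
    show "(\<Prod>i\<in>{1..n}. case_prod f (?split \<sigma> i)) = (\<Prod>i\<in>{1..n}. f (\<sigma> i) (\<sigma> (i + n)))"
      by (intro prod.cong) auto
  next
    fix g assume g: "g \<in> ?P"
    have mem: "g i \<in> {-1, 1} \<times> {-1, 1}" if "i \<in> {1..n}" for i
      using g that by (rule PiE_mem)
    show "?join g \<in> configs (2 * n)"
      unfolding configs_def
    proof (rule restrict_PiE_iff[THEN iffD2], intro ballI)
      fix j assume j: "j \<in> {1..2 * n}"
      then consider "j \<in> {1..n}" | "\<not> j \<le> n" "j - n \<in> {1..n}" by fastforce
      then show "(if j \<le> n then fst (g j) else snd (g (j - n))) \<in> {- 1, 1}"
        by cases (use mem[of j] mem[of "j - n"] in auto)
    qed
    show "?split (?join g) = g"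
    proof
      fix i show "?split (?join g) i = g i"
      proof (cases "i \<in> {1..n}")
        case False
        then have "g i = undefined" using g by (rule PiE_arb[rotated])
        then show ?thesis using False by simp
      qed auto
    qed
  qed
  also have "\<dots> = (\<Prod>i\<in>{1..n}. \<Sum>p\<in>{-1, 1} \<times> {-1, 1}. case_prod f p)"
    by (rule prod_sum_PiE[symmetric]) auto
  also have "\<dots> = (\<Sum>s\<in>{-1, 1}. \<Sum>t\<in>{-1, 1}. f s t) ^ n"
    by (simp add: add.assoc)
  finally show ?thesis .
qed

lemma block1_double: "block1 (2 * n) = {1..n}" and block2_double: "block2 (2 * n) = {n + 1..2 * n}"
  by (simp_all add: block1_def block2_def)

lemma overlap_double: "overlap (2 * n) \<sigma> = (\<Sum>i\<in>{1..n}. \<sigma> i * \<sigma> (i + n))"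
  by (simp add: overlap_def block1_double)

lemma sum_block2_shift: "(\<Sum>i\<in>{n + 1..2 * n}. f i) = (\<Sum>i\<in>{1..n}. f (i + n :: nat))"
  using sum.shift_bounds_cl_nat_ivl[of f 1 n n] by (simp add: mult_2 add.commute)

lemma block_magnetization_double:
  "block_magnetization (2 * n) \<sigma> =
     ((\<Sum>i\<in>{1..n}. \<sigma> i) / real n, (\<Sum>i\<in>{1..n}. \<sigma> (i + n)) / real n)"
  unfolding block_magnetization_def block1_double block2_double sum_block2_shift by simp

lemma minus_hamiltonian:
  assumes "n > 0" and m: "block_magnetization (2 * n) \<sigma> = (m\<^sub>1, m\<^sub>2)"
  shows "- hamiltonian (2 * n) \<alpha> (2 * \<gamma>) \<sigma> =
    real n * (\<gamma> / 2 * (m\<^sub>1\<^sup>2 + m\<^sub>2\<^sup>2)) + \<alpha> * overlap (2 * n) \<sigma>"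
proof -
  have S: "(\<Sum>i\<in>block1 (2 * n). \<sigma> i) = real n * m\<^sub>1" "(\<Sum>i\<in>block2 (2 * n). \<sigma> i) = real n * m\<^sub>2"
    using assms by (auto simp: block_magnetization_def)
  have "- hamiltonian (2 * n) \<alpha> (2 * \<gamma>) \<sigma> =
      \<gamma> / (2 * real n) * ((real n * m\<^sub>1)\<^sup>2 + (real n * m\<^sub>2)\<^sup>2) + \<alpha> * overlap (2 * n) \<sigma>"
    by (simp add: hamiltonian_def overlap_def sum_product[symmetric] S power2_eq_square)
  also have "\<gamma> / (2 * real n) * ((real n * m\<^sub>1)\<^sup>2 + (real n * m\<^sub>2)\<^sup>2) =
      real n * (\<gamma> / 2 * (m\<^sub>1\<^sup>2 + m\<^sub>2\<^sup>2))"
    using \<open>n > 0\<close> by (simp add: power2_eq_square field_simps)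
  finally show ?thesis .
qed

text \<open>The exponent \<open>- H\<close> with the convex part \<open>\<gamma> / 2 * |m|\<^sup>2\<close> replaced by its tangent at \<open>m = y\<close>.\<close>

definition linearized_exponent :: "nat \<Rightarrow> real \<Rightarrow> real \<Rightarrow> real \<times> real \<Rightarrow> (nat \<Rightarrow> real) \<Rightarrow> real" where
  "linearized_exponent n \<alpha> \<gamma> y \<sigma> =
     real n * (\<gamma> * (y \<bullet> block_magnetization (2 * n) \<sigma>) - \<gamma> / 2 * (norm y)\<^sup>2) + \<alpha> * overlap (2 * n) \<sigma>"

text \<open>The gap between the convex part and its tangent is a square: it is nonnegative and vanishes on the
  configurations with magnetization \<open>y\<close>. The first property gives lower, the second upper bounds for partition
  functions.\<close>

lemma minus_hamiltonian_eq_linearized: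
  assumes "n > 0"
  shows "- hamiltonian (2 * n) \<alpha> (2 * \<gamma>) \<sigma> =
    linearized_exponent n \<alpha> \<gamma> y \<sigma> + real n * (\<gamma> / 2 * (norm (block_magnetization (2 * n) \<sigma> - y))\<^sup>2)"
proof -
  obtain m\<^sub>1 m\<^sub>2 where m: "block_magnetization (2 * n) \<sigma> = (m\<^sub>1, m\<^sub>2)" by (cases "block_magnetization (2 * n) \<sigma>")
  show ?thesis
    unfolding minus_hamiltonian[OF assms m] linearized_exponent_def m
    by (cases y) (simp add: power2_norm_eq_inner inner_Pair, simp add: power2_eq_square algebra_simps)
qed

text \<open>The linearized exponent is a sum over the pairs \<open>(\<sigma> i, \<sigma> (i + n))\<close>. The factor with \<open>cosh\<close> and \<open>sinh\<close> is the
  expectation of \<open>exp (\<alpha> * s * t)\<close> for independent spins \<open>s\<close>, \<open>t\<close> with means \<open>tanh (\<gamma> * y\<^sub>1)\<close> and \<open>tanh (\<gamma> * y\<^sub>2)\<close>.\<close>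

lemma sum_exp_linearized:
  assumes "n > 0"
  shows "(\<Sum>\<sigma>\<in>configs (2 * n). exp (linearized_exponent n \<alpha> \<gamma> (y\<^sub>1, y\<^sub>2) \<sigma>)) =
    (site_weight \<gamma> y\<^sub>1 * site_weight \<gamma> y\<^sub>2 *
      (cosh \<alpha> + sinh \<alpha> * (tanh (\<gamma> * y\<^sub>1) * tanh (\<gamma> * y\<^sub>2)))) ^ n"
proof -
  let ?f = "\<lambda>s t. exp (\<gamma> * (y\<^sub>1 * s + y\<^sub>2 * t) - \<gamma> / 2 * (y\<^sub>1\<^sup>2 + y\<^sub>2\<^sup>2) + \<alpha> * (s * t))"
  have "exp (linearized_exponent n \<alpha> \<gamma> (y\<^sub>1, y\<^sub>2) \<sigma>) = (\<Prod>i\<in>{1..n}. ?f (\<sigma> i) (\<sigma> (i + n)))" for \<sigma>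
  proof -
    have "linearized_exponent n \<alpha> \<gamma> (y\<^sub>1, y\<^sub>2) \<sigma> =
        (\<Sum>i\<in>{1..n}. \<gamma> * (y\<^sub>1 * \<sigma> i + y\<^sub>2 * \<sigma> (i + n)) - \<gamma> / 2 * (y\<^sub>1\<^sup>2 + y\<^sub>2\<^sup>2) + \<alpha> * (\<sigma> i * \<sigma> (i + n)))"
      unfolding linearized_exponent_def block_magnetization_double overlap_double
        sum.distrib sum_subtractf sum_distrib_left[symmetric]
      using assms by (simp add: inner_Pair norm_Pair field_simps)
    then show ?thesis by (simp add: exp_sum)
  qed
  then have "(\<Sum>\<sigma>\<in>configs (2 * n). exp (linearized_exponent n \<alpha> \<gamma> (y\<^sub>1, y\<^sub>2) \<sigma>)) =
      (\<Sum>s\<in>{-1, 1}. \<Sum>t\<in>{-1, 1}. ?f s t) ^ n"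
    using sum_configs_prod_pairs[of ?f n] by simp
  also have "(\<Sum>s\<in>{-1, 1}. \<Sum>t\<in>{-1, 1}. ?f s t) = site_weight \<gamma> y\<^sub>1 * site_weight \<gamma> y\<^sub>2 *
      (cosh \<alpha> + sinh \<alpha> * (tanh (\<gamma> * y\<^sub>1) * tanh (\<gamma> * y\<^sub>2)))"
  proof -
    have "cosh (\<gamma> * y\<^sub>1) \<noteq> 0" "cosh (\<gamma> * y\<^sub>2) \<noteq> 0" by simp_all
    then have "site_weight \<gamma> y\<^sub>1 * site_weight \<gamma> y\<^sub>2 *
        (cosh \<alpha> + sinh \<alpha> * (tanh (\<gamma> * y\<^sub>1) * tanh (\<gamma> * y\<^sub>2))) =
      4 * exp (- (\<gamma> / 2 * y\<^sub>1\<^sup>2)) * exp (- (\<gamma> / 2 * y\<^sub>2\<^sup>2)) *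
        (cosh \<alpha> * cosh (\<gamma> * y\<^sub>1) * cosh (\<gamma> * y\<^sub>2) + sinh \<alpha> * sinh (\<gamma> * y\<^sub>1) * sinh (\<gamma> * y\<^sub>2))"
      by (simp add: site_weight_def tanh_def field_simps)
    also have "\<dots> = (\<Sum>s\<in>{-1, 1}. \<Sum>t\<in>{-1, 1}. exp (- (\<gamma> / 2 * y\<^sub>1\<^sup>2)) * exp (- (\<gamma> / 2 * y\<^sub>2\<^sup>2)) *
        exp (\<gamma> * y\<^sub>1 * s) * exp (\<gamma> * y\<^sub>2 * t) * exp (\<alpha> * (s * t)))"
      by (simp add: cosh_field_def sinh_field_def) (simp add: field_simps del: exp_minus)
    also have "\<dots> = (\<Sum>s\<in>{-1, 1}. \<Sum>t\<in>{-1, 1}. ?f s t)"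
      by (intro sum.cong refl) (simp add: exp_add[symmetric] algebra_simps)
    finally show ?thesis by simp
  qed
  finally show ?thesis .
qed

section \<open>Restricted partition functions and spin flips\<close>

text \<open>The block size \<open>n = N / 2\<close> and \<open>\<gamma> = \<beta> / 2\<close>, the inverse temperature of each block as a Curie--Weiss model,
  are the natural parameters, as parity and division by two then never appear.\<close>

definition restricted_partition :: "nat \<Rightarrow> real \<Rightarrow> real \<Rightarrow> (real \<times> real) set \<Rightarrow> real" where
  "restricted_partition n \<alpha> \<gamma> A =
     (\<Sum>\<sigma> | \<sigma> \<in> configs (2 * n) \<and> block_magnetization (2 * n) \<sigma> \<in> A.
        exp (- hamiltonian (2 * n) \<alpha> (2 * \<gamma>) \<sigma>))"

lemma finite_configs_Collect [simp]: "finite {\<sigma>. \<sigma> \<in> configs N \<and> P \<sigma>}"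
  using finite_configs by simp

lemma restricted_partition_mono: "A \<subseteq> B \<Longrightarrow> restricted_partition n \<alpha> \<gamma> A \<le> restricted_partition n \<alpha> \<gamma> B"
  unfolding restricted_partition_def by (intro sum_mono2) auto

lemma restricted_partition_UNIV: "restricted_partition n \<alpha> \<gamma> UNIV = partition_function (2 * n) \<alpha> (2 * \<gamma>)"
  by (simp add: restricted_partition_def partition_function_def)

lemma measure_magnetization_law:
  assumes "A \<in> sets borel"
  shows "measure (magnetization_law (2 * n) \<alpha> (2 * \<gamma>)) A =
    restricted_partition n \<alpha> \<gamma> A / restricted_partition n \<alpha> \<gamma> UNIV"
proof -
  let ?S = "{\<sigma>. \<sigma> \<in> configs (2 * n) \<and> block_magnetization (2 * n) \<sigma> \<in> A}"
  let ?Z = "partition_function (2 * n) \<alpha> (2 * \<gamma>)"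
  have "measure (magnetization_law (2 * n) \<alpha> (2 * \<gamma>)) A = measure (gibbs (2 * n) \<alpha> (2 * \<gamma>)) ?S"
    using assms unfolding magnetization_law_def
    by (subst measure_distr) (auto intro!: arg_cong2[where f = measure] simp: gibbs_def space_point_measure)
  also have "\<dots> = (\<Sum>\<sigma>\<in>?S. exp (- hamiltonian (2 * n) \<alpha> (2 * \<gamma>) \<sigma>) / ?Z)"
    using partition_function_pos[of "2 * n" \<alpha> "2 * \<gamma>"] unfolding gibbs_def
    by (subst measure_def, subst emeasure_point_measure_finite[OF finite_configs])
      (auto simp: sum_nonneg)
  also have "\<dots> = restricted_partition n \<alpha> \<gamma> A / restricted_partition n \<alpha> \<gamma> UNIV"
    by (simp add: restricted_partition_UNIV sum_divide_distrib[symmetric]) (simp add: restricted_partition_def)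
  finally show ?thesis .
qed

lemma exp_minus_hamiltonian_shift:
  "exp (- hamiltonian N \<alpha> \<beta> \<sigma>) = exp (- hamiltonian N \<alpha>' \<beta> \<sigma>) * exp ((\<alpha> - \<alpha>') * overlap N \<sigma>)"
  by (simp add: exp_add[symmetric] hamiltonian_def overlap_def algebra_simps)

lemma configs_memD: "\<sigma> \<in> configs N \<Longrightarrow> i \<in> {1..N} \<Longrightarrow> \<sigma> i \<in> {-1, 1}"
  unfolding configs_def by (rule PiE_mem)

lemma abs_overlap_le:
  assumes "\<sigma> \<in> configs (2 * n)"
  shows "\<bar>overlap (2 * n) \<sigma>\<bar> \<le> real n"
proof -
  have "\<bar>overlap (2 * n) \<sigma>\<bar> \<le> (\<Sum>i\<in>{1..n}. \<bar>\<sigma> i * \<sigma> (i + n)\<bar>)"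
    unfolding overlap_double by (rule sum_abs)
  also have "\<dots> \<le> (\<Sum>i\<in>{1..n}. 1)"
  proof (rule sum_mono)
    fix i assume i: "i \<in> {1..n}"
    then show "\<bar>\<sigma> i * \<sigma> (i + n)\<bar> \<le> 1"
      using configs_memD[OF assms, of i] configs_memD[OF assms, of "i + n"] by auto
  qed
  finally show ?thesis by simp
qed

text \<open>The coupling term is bounded by \<open>\<bar>\<alpha>\<bar> * n\<close>, which makes the coupling subexponential when \<open>\<alpha> \<rightarrow> 0\<close> and
  negligible when \<open>n * \<alpha> \<rightarrow> 0\<close>.\<close>

lemma restricted_partition_change_coupling:
  "restricted_partition n \<alpha> \<gamma> A \<le> exp (\<bar>\<alpha> - \<alpha>'\<bar> * real n) * restricted_partition n \<alpha>' \<gamma> A"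
  unfolding restricted_partition_def sum_distrib_left
proof (rule sum_mono)
  fix \<sigma> assume "\<sigma> \<in> {\<sigma> \<in> configs (2 * n). block_magnetization (2 * n) \<sigma> \<in> A}"
  then have "\<bar>(\<alpha> - \<alpha>') * overlap (2 * n) \<sigma>\<bar> \<le> \<bar>\<alpha> - \<alpha>'\<bar> * real n"
    by (auto simp: abs_mult intro!: mult_left_mono abs_overlap_le)
  then have "exp ((\<alpha> - \<alpha>') * overlap (2 * n) \<sigma>) \<le> exp (\<bar>\<alpha> - \<alpha>'\<bar> * real n)" by simp
  then show "exp (- hamiltonian (2 * n) \<alpha> (2 * \<gamma>) \<sigma>) \<le>
      exp (\<bar>\<alpha> - \<alpha>'\<bar> * real n) * exp (- hamiltonian (2 * n) \<alpha>' (2 * \<gamma>) \<sigma>)"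
    by (subst exp_minus_hamiltonian_shift[of _ \<alpha> _ _ \<alpha>']) simp
qed

definition flip :: "nat set \<Rightarrow> (nat \<Rightarrow> real) \<Rightarrow> nat \<Rightarrow> real" where
  "flip D \<sigma> i = (if i \<in> D then - \<sigma> i else \<sigma> i)"

lemma flip_flip: "flip D (flip D \<sigma>) = \<sigma>"
  by (auto simp: flip_def)

lemma flip_in_configs:
  assumes "\<sigma> \<in> configs N" "D \<subseteq> {1..N}"
  shows "flip D \<sigma> \<in> configs N"
  unfolding configs_def
proof (rule PiE_I)
  show "flip D \<sigma> i \<in> {-1, 1}" if "i \<in> {1..N}" for i
    using configs_memD[OF assms(1) that] by (auto simp: flip_def)
  show "flip D \<sigma> i = undefined" if "i \<notin> {1..N}" for i
    using assms that unfolding flip_def configs_def by (auto dest: PiE_arb)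
qed

lemma restricted_partition_flip:
  assumes D: "D \<subseteq> {1..2 * n}"
    and H: "\<And>\<sigma>. hamiltonian (2 * n) \<alpha> (2 * \<gamma>) (flip D \<sigma>) = hamiltonian (2 * n) \<alpha>' (2 * \<gamma>) \<sigma>"
    and m: "\<And>\<sigma>. block_magnetization (2 * n) (flip D \<sigma>) = h (block_magnetization (2 * n) \<sigma>)"
  shows "restricted_partition n \<alpha>' \<gamma> (h -` A) = restricted_partition n \<alpha> \<gamma> A"
  unfolding restricted_partition_def
  by (rule sum.reindex_bij_witness[where i = "flip D" and j = "flip D"])
    (use flip_flip m[of "flip D _"] in \<open>auto simp: H m flip_in_configs[OF _ D] flip_flip\<close>)

text \<open>Flipping the second block turns ferromagnetic into antiferromagnetic coupling. This reduces the mass near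
  \<open>(m\<^sup>+, m\<^sup>-)\<close> to that near \<open>(m\<^sup>+, m\<^sup>+)\<close> for the opposite coupling.\<close>

lemma restricted_partition_flip_block2:
  "restricted_partition n (- \<alpha>) \<gamma> ((\<lambda>(x, y). (x, - y)) -` A) = restricted_partition n \<alpha> \<gamma> A"
proof (rule restricted_partition_flip[where D = "block2 (2 * n)"])
  show "block2 (2 * n) \<subseteq> {1..2 * n}" by (auto simp: block2_def)
  have 1: "flip (block2 (2 * n)) \<sigma> i = \<sigma> i" if "i \<in> block1 (2 * n)" for \<sigma> i
    using that by (auto simp: flip_def block1_def block2_def)
  have 2: "flip (block2 (2 * n)) \<sigma> i = - \<sigma> i" if "i \<in> block2 (2 * n)" for \<sigma> i
    using that by (simp add: flip_def)
  have 3: "flip (block2 (2 * n)) \<sigma> (i + n) = - \<sigma> (i + n)" if "i \<in> block1 (2 * n)" for \<sigma> i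
    using that by (auto simp: flip_def block1_def block2_def)
  show "hamiltonian (2 * n) \<alpha> (2 * \<gamma>) (flip (block2 (2 * n)) \<sigma>) = hamiltonian (2 * n) (- \<alpha>) (2 * \<gamma>) \<sigma>" for \<sigma>
    by (simp add: hamiltonian_def 1 2 3 sum_negf cong: sum.cong)
  show "block_magnetization (2 * n) (flip (block2 (2 * n)) \<sigma>) =
      (\<lambda>(x, y). (x, - y)) (block_magnetization (2 * n) \<sigma>)" for \<sigma>
    by (simp add: block_magnetization_def 1 2 sum_negf cong: sum.cong)
qed

lemma restricted_partition_flip_all: "restricted_partition n \<alpha> \<gamma> (uminus -` A) = restricted_partition n \<alpha> \<gamma> A"
proof (rule restricted_partition_flip)
  let ?D = "block1 (2 * n) \<union> block2 (2 * n)"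
  show "?D \<subseteq> {1..2 * n}" by (auto simp: block1_def block2_def)
  have 1: "flip ?D \<sigma> i = - \<sigma> i" if "i \<in> block1 (2 * n)" for \<sigma> i
    using that by (simp add: flip_def)
  have 2: "flip ?D \<sigma> i = - \<sigma> i" if "i \<in> block2 (2 * n)" for \<sigma> i
    using that by (simp add: flip_def)
  have 3: "flip ?D \<sigma> (i + n) = - \<sigma> (i + n)" if "i \<in> block1 (2 * n)" for \<sigma> i
    using that by (auto simp: flip_def block1_def block2_def)
  show "hamiltonian (2 * n) \<alpha> (2 * \<gamma>) (flip ?D \<sigma>) = hamiltonian (2 * n) \<alpha> (2 * \<gamma>) \<sigma>" for \<sigma>
    by (simp add: hamiltonian_def 1 2 3 cong: sum.cong)
  show "block_magnetization (2 * n) (flip ?D \<sigma>) = - block_magnetization (2 * n) \<sigma>" for \<sigma>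
    by (simp add: block_magnetization_def 1 2 sum_negf cong: sum.cong)
qed

text \<open>The partition function is even in \<open>\<alpha>\<close> by the flip of the second block; averaging over both signs replaces
  \<open>exp (\<alpha> * X)\<close> by \<open>cosh (\<alpha> * X) \<ge> 1\<close>.\<close>

lemma restricted_partition_UNIV_ge_uncoupled: "restricted_partition n 0 \<gamma> UNIV \<le> restricted_partition n \<alpha> \<gamma> UNIV"
proof -
  have "restricted_partition n (- \<alpha>) \<gamma> UNIV = restricted_partition n \<alpha> \<gamma> UNIV"
    using restricted_partition_flip_block2[of n \<alpha> \<gamma> UNIV] by simp
  have two_cosh: "2 * cosh x = exp x + exp (- x)" for x :: real by (simp add: cosh_field_def)
  have "2 * restricted_partition n \<alpha> \<gamma> UNIV = restricted_partition n \<alpha> \<gamma> UNIV + restricted_partition n (- \<alpha>) \<gamma> UNIV"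
    using \<open>restricted_partition n (- \<alpha>) \<gamma> UNIV = restricted_partition n \<alpha> \<gamma> UNIV\<close> by simp
  also have "\<dots> = (\<Sum>\<sigma>\<in>configs (2 * n). exp (- hamiltonian (2 * n) 0 (2 * \<gamma>) \<sigma>) *
      (2 * cosh (\<alpha> * overlap (2 * n) \<sigma>)))"
    unfolding restricted_partition_def
    by (subst (1 2) exp_minus_hamiltonian_shift[where \<alpha>' = 0])
      (simp add: sum.distrib[symmetric] two_cosh algebra_simps del: exp_minus)
  also have "\<dots> \<ge> (\<Sum>\<sigma>\<in>configs (2 * n). exp (- hamiltonian (2 * n) 0 (2 * \<gamma>) \<sigma>) * (2 * 1))"
    by (intro sum_mono mult_left_mono cosh_real_ge_1) auto
  finally show ?thesis by (simp add: restricted_partition_def sum_distrib_right[symmetric])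
qed

lemma spin_sum_integer:
  fixes \<sigma> :: "nat \<Rightarrow> real"
  assumes "finite I" "\<And>i. i \<in> I \<Longrightarrow> \<sigma> i \<in> {-1, 1}"
  shows "\<exists>k::int. k \<in> {- int (card I)..int (card I)} \<and> sum \<sigma> I = of_int k"
  using assms
proof (induction I)
  case (insert i I)
  then obtain k where k: "k \<in> {- int (card I)..int (card I)}" "sum \<sigma> I = of_int k" by auto
  have "\<sigma> i = -1 \<or> \<sigma> i = 1" using insert.prems by auto
  then show ?case
    using k insert.hyps by (elim disjE) (rule exI[of _ "k - 1"] exI[of _ "k + 1"], force)+
qed simp

lemma block_magnetization_in_grid:
  assumes "\<sigma> \<in> configs (2 * n)"
  shows "block_magnetization (2 * n) \<sigma> \<in>
    (\<lambda>(k, l). (real_of_int k / real n, real_of_int l / real n)) ` ({- int n..int n} \<times> {- int n..int n})"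
proof -
  obtain k where k: "k \<in> {- int n..int n}" "(\<Sum>i\<in>{1..n}. \<sigma> i) = of_int k"
    using spin_sum_integer[of "{1..n}" \<sigma>] configs_memD[OF assms] by fastforce
  obtain l where l: "l \<in> {- int n..int n}" "(\<Sum>i\<in>{1..n}. \<sigma> (i + n)) = of_int l"
    using spin_sum_integer[of "{1..n}" "\<lambda>i. \<sigma> (i + n)"] configs_memD[OF assms, of "_ + n"] by fastforce
  show ?thesis
    unfolding block_magnetization_double k l
    by (rule image_eqI[of _ _ "(k, l)"]) (use k l in auto)
qed

lemma cosh_plus_sinh_mult_pos:
  fixes \<alpha> t :: real
  assumes "\<bar>t\<bar> \<le> 1"
  shows "0 < cosh \<alpha> + sinh \<alpha> * t"
proof -
  have "\<bar>sinh \<alpha> * t\<bar> \<le> \<bar>sinh \<alpha>\<bar>" using assms by (simp add: abs_mult mult_left_le)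
  also have "\<dots> = sinh \<bar>\<alpha>\<bar>" by (simp add: abs_if)
  also have "\<dots> < cosh \<bar>\<alpha>\<bar>" by (rule sinh_less_cosh_real)
  finally show ?thesis by simp
qed

text \<open>On the configurations with magnetization \<open>y\<close> the weight equals the linearized weight, whose sum over all
  configurations is an explicit power. Only polynomially many values \<open>y\<close> occur, since they lie on a grid.\<close>

lemma restricted_partition_le:
  assumes "n > 0" and "R \<ge> 0"
    and R: "\<And>y\<^sub>1 y\<^sub>2. (y\<^sub>1, y\<^sub>2) \<in> A \<Longrightarrow> \<bar>y\<^sub>1\<bar> \<le> 1 \<Longrightarrow> \<bar>y\<^sub>2\<bar> \<le> 1 \<Longrightarrow>
      site_weight \<gamma> y\<^sub>1 * site_weight \<gamma> y\<^sub>2 *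
        (cosh \<alpha> + sinh \<alpha> * (tanh (\<gamma> * y\<^sub>1) * tanh (\<gamma> * y\<^sub>2))) \<le> R"
  shows "restricted_partition n \<alpha> \<gamma> A \<le> (2 * real n + 1)\<^sup>2 * R ^ n"
proof -
  let ?m = "block_magnetization (2 * n)"
  let ?S = "{\<sigma>. \<sigma> \<in> configs (2 * n) \<and> ?m \<sigma> \<in> A}"
  let ?grid = "(\<lambda>(k, l). (real_of_int k / real n, real_of_int l / real n)) ` ({- int n..int n} \<times> {- int n..int n})"
  have sub: "?m ` ?S \<subseteq> ?grid" using block_magnetization_in_grid by auto
  have "card ?grid \<le> card ({- int n..int n} \<times> {- int n..int n})" by (rule card_image_le) simp
  also have "\<dots> = (2 * n + 1)\<^sup>2" by (simp add: power2_eq_square nat_add_distrib nat_mult_distrib)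
  finally have "card (?m ` ?S) \<le> (2 * n + 1)\<^sup>2"
    using card_mono[OF _ sub] by fastforce
  from of_nat_mono[OF this, where 'a = real]
  have card: "real (card (?m ` ?S)) \<le> (2 * real n + 1)\<^sup>2"
    by (simp add: add.commute)
  have "restricted_partition n \<alpha> \<gamma> A = (\<Sum>y\<in>?m ` ?S. \<Sum>\<sigma>\<in>{\<sigma> \<in> ?S. ?m \<sigma> = y}. exp (- hamiltonian (2 * n) \<alpha> (2 * \<gamma>) \<sigma>))"
    unfolding restricted_partition_def by (rule sum.image_gen) simp
  also have "\<dots> \<le> (\<Sum>y\<in>?m ` ?S. R ^ n)"
  proof (rule sum_mono)
    fix y assume y: "y \<in> ?m ` ?S"
    obtain y\<^sub>1 y\<^sub>2 where y12: "y = (y\<^sub>1, y\<^sub>2)" by (cases y)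
    have "y \<in> ?grid" using sub y by blast
    then have bounds: "\<bar>y\<^sub>1\<bar> \<le> 1" "\<bar>y\<^sub>2\<bar> \<le> 1" using \<open>n > 0\<close> by (auto simp: y12 field_simps)
    have "(\<Sum>\<sigma>\<in>{\<sigma> \<in> ?S. ?m \<sigma> = y}. exp (- hamiltonian (2 * n) \<alpha> (2 * \<gamma>) \<sigma>)) =
        (\<Sum>\<sigma>\<in>{\<sigma> \<in> ?S. ?m \<sigma> = y}. exp (linearized_exponent n \<alpha> \<gamma> y \<sigma>))"
      by (intro sum.cong refl) (simp add: minus_hamiltonian_eq_linearized[OF \<open>n > 0\<close>, of _ _ _ y])
    also have "\<dots> \<le> (\<Sum>\<sigma>\<in>configs (2 * n). exp (linearized_exponent n \<alpha> \<gamma> y \<sigma>))"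
      by (intro sum_mono2 finite_configs) auto
    also have "\<dots> \<le> R ^ n"
      unfolding y12 sum_exp_linearized[OF \<open>n > 0\<close>]
    proof (rule power_mono)
      show "site_weight \<gamma> y\<^sub>1 * site_weight \<gamma> y\<^sub>2 *
          (cosh \<alpha> + sinh \<alpha> * (tanh (\<gamma> * y\<^sub>1) * tanh (\<gamma> * y\<^sub>2))) \<le> R"
        using y bounds by (intro R) (auto simp: y12)
      have "\<bar>tanh (\<gamma> * y\<^sub>1)\<bar> * \<bar>tanh (\<gamma> * y\<^sub>2)\<bar> \<le> 1 * 1"
        by (intro mult_mono) (simp_all add: abs_le_iff less_imp_le tanh_real_lt_1 tanh_real_gt_neg1 minus_le_iff)
      then show "0 \<le> site_weight \<gamma> y\<^sub>1 * site_weight \<gamma> y\<^sub>2 *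
          (cosh \<alpha> + sinh \<alpha> * (tanh (\<gamma> * y\<^sub>1) * tanh (\<gamma> * y\<^sub>2)))"
        by (intro mult_nonneg_nonneg less_imp_le[OF site_weight_pos] less_imp_le[OF cosh_plus_sinh_mult_pos])
          (simp add: abs_mult)
    qed
    finally show "(\<Sum>\<sigma>\<in>{\<sigma> \<in> ?S. ?m \<sigma> = y}. exp (- hamiltonian (2 * n) \<alpha> (2 * \<gamma>) \<sigma>)) \<le> R ^ n" .
  qed
  also have "\<dots> = real (card (?m ` ?S)) * R ^ n" by simp
  also have "\<dots> \<le> (2 * real n + 1)\<^sup>2 * R ^ n"
    using card \<open>R \<ge> 0\<close> by (intro mult_right_mono) (simp_all)
  finally show ?thesis .
qed

text \<open>The linearized weight never exceeds the true weight, for any choice of the tangent point.\<close>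

lemma restricted_partition_UNIV_ge:
  assumes "n > 0" "\<gamma> \<ge> 0"
  shows "(site_weight \<gamma> y\<^sub>1 * site_weight \<gamma> y\<^sub>2) ^ n \<le> restricted_partition n \<alpha> \<gamma> UNIV"
proof -
  have "(site_weight \<gamma> y\<^sub>1 * site_weight \<gamma> y\<^sub>2) ^ n =
      (\<Sum>\<sigma>\<in>configs (2 * n). exp (linearized_exponent n 0 \<gamma> (y\<^sub>1, y\<^sub>2) \<sigma>))"
    using sum_exp_linearized[OF \<open>n > 0\<close>, of 0] by simp
  also have "\<dots> \<le> restricted_partition n 0 \<gamma> UNIV"
    unfolding restricted_partition_def
    by (simp, intro sum_mono)
      (use assms in \<open>simp add: minus_hamiltonian_eq_linearized[OF \<open>n > 0\<close>, of _ _ _ "(y\<^sub>1, y\<^sub>2)"]\<close>)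
  also have "\<dots> \<le> restricted_partition n \<alpha> \<gamma> UNIV" by (rule restricted_partition_UNIV_ge_uncoupled)
  finally show ?thesis .
qed

section \<open>Exponential bounds on atypical configurations\<close>

definition corners :: "real \<Rightarrow> (real \<times> real) set" where
  "corners m = {m, - m} \<times> {m, - m}"

lemma corner_mem:
  "(m, m) \<in> corners m" "(m, - m) \<in> corners m" "(- m, m) \<in> corners m" "(- m, - m) \<in> corners m"
  by (simp_all add: corners_def)

text \<open>Distinct corners differ by \<open>2 * m\<close> in some coordinate.\<close>

lemma corners_disjoint: "disjoint_family_on (\<lambda>c. ball c m) (corners m)"
  unfolding disjoint_family_on_def
proof (intro ballI impI equals0I)
  fix c d x assume cd: "c \<in> corners m" "d \<in> corners m" "c \<noteq> d" and "x \<in> ball c m \<inter> ball d m"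
  then have "dist c d < 2 * m" using dist_triangle[of c d x] by (simp add: dist_commute[of x])
  moreover have "dist (fst c) (fst d) \<le> dist c d" "dist (snd c) (snd d) \<le> dist c d"
    by (rule dist_fst_le, rule dist_snd_le)
  ultimately show False using cd by (auto simp: corners_def dist_real_def)
qed

lemma indicator_ball_corner:
  assumes "c \<in> corners m" "x \<in> corners m" "0 < \<epsilon>" "\<epsilon> < m"
  shows "indicat_real (ball c \<epsilon>) x = of_bool (x = c)"
proof (cases "x = c")
  case False
  then have "ball c m \<inter> ball x m = {}"
    using disjoint_family_onD[OF corners_disjoint assms(1,2)] by simp
  moreover have "x \<in> ball x m" using assms(3,4) by simp
  ultimately have "x \<notin> ball c m" by blast
  then show ?thesis using False assms(4) by (simp add: indicator_def)
qed (use assms in simp)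

lemma site_weight_le_max:
  assumes "\<gamma> > 1"
  shows "site_weight \<gamma> y \<le> site_weight \<gamma> (m_plus \<gamma>)"
proof (cases "\<bar>y\<bar> = m_plus \<gamma>")
  case True
  then have "y = m_plus \<gamma> \<or> y = - m_plus \<gamma>" by auto
  then show ?thesis by (auto simp: site_weight_minus)
qed (use site_weight_less_max[OF assms, of y] in simp)

text \<open>Strict inequality between bases of \<open>n\<close>-th powers, in the form of an exponential rate; \<open>R\<close> may be
  nonpositive here.\<close>

lemma ex_exp_rate:
  fixes R S :: real
  assumes "R < S" "0 < S"
  shows "\<exists>\<kappa>>0. R \<le> S * exp (- \<kappa>)"
proof (intro exI conjI)
  let ?r = "max R (S / 2) / S"
  have r: "0 < ?r" "?r < 1" using assms by (auto simp: max_def)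
  then show "- ln ?r > 0" by simp
  show "R \<le> S * exp (- (- ln ?r))" using r assms by simp
qed

text \<open>Away from the corners the product of the two site weights stays below its maximum by a fixed factor, by
  compactness of the square \<open>[-1, 1]\<^sup>2\<close> of possible magnetizations. The full partition function is bounded below by
  the value of the power at a corner.\<close>

lemma restricted_partition_far_le:
  assumes "\<gamma> > 1" "\<epsilon> > 0"
  defines "far \<equiv> - (\<Union>c\<in>corners (m_plus \<gamma>). ball c \<epsilon>)"
  shows "\<exists>\<kappa>>0. \<forall>n>0. \<forall>\<alpha>. restricted_partition n \<alpha> \<gamma> far \<le>
    (2 * real n + 1)\<^sup>2 * exp (\<bar>\<alpha>\<bar> * real n - \<kappa> * real n) * restricted_partition n \<alpha> \<gamma> UNIV"
proof -
  define m where "m = m_plus \<gamma>"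
  let ?w = "site_weight \<gamma>"
  let ?K = "({-1..1} \<times> {-1..1}) \<inter> far"
  let ?h = "\<lambda>y. ?w (fst y) * ?w (snd y)"
  have m: "m > 0" unfolding m_def by (rule mean_field_equation_unimodal) fact
  have wpos: "?w y > 0" for y by (rule site_weight_pos)
  have wle: "?w y \<le> ?w m" for y unfolding m_def by (rule site_weight_le_max) fact
  have K_less: "?h y < ?w m * ?w m" if "y \<in> ?K" for y
  proof -
    obtain a b where y: "y = (a, b)" by (cases y)
    have "y \<notin> corners m" using that \<open>\<epsilon> > 0\<close> unfolding far_def m_def by force
    then consider "\<bar>a\<bar> \<noteq> m" | "\<bar>b\<bar> \<noteq> m" by (auto simp: corners_def y abs_if split: if_splits)
    then show ?thesis
    proof cases
      case 1
      then have "?w a < ?w m" using site_weight_less_max[OF \<open>\<gamma> > 1\<close>, of a] by (simp add: m_def)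
      then show ?thesis using wle[of b] wpos by (simp add: y mult_less_le_imp_less less_imp_le)
    next
      case 2
      then have "?w b < ?w m" using site_weight_less_max[OF \<open>\<gamma> > 1\<close>, of b] by (simp add: m_def)
      then show ?thesis using wle[of a] wpos by (simp add: y mult_le_less_imp_less less_imp_le)
    qed
  qed
  have "compact ?K"
    unfolding far_def by (intro compact_Int_closed compact_Times compact_Icc closed_Compl open_UN ballI open_ball)
  \<comment> \<open>For large \<open>\<epsilon>\<close> the compact set is empty and has no maximum to take.\<close>
  have "\<exists>R<?w m * ?w m. \<forall>y\<in>?K. ?h y \<le> R"
  proof (cases "?K = {}")
    case True
    then show ?thesis using lt_ex[of "?w m * ?w m"] by (metis empty_iff)
  next
    case False
    have "continuous_on ?K ?h" by (intro continuous_intros)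
    from continuous_attains_sup[OF \<open>compact ?K\<close> False this]
    show ?thesis using K_less by blast
  qed
  then obtain R where R: "R < ?w m * ?w m" "\<And>y. y \<in> ?K \<Longrightarrow> ?h y \<le> R" by blast
  obtain \<kappa> where \<kappa>: "\<kappa> > 0" "R \<le> ?w m * ?w m * exp (- \<kappa>)"
    using ex_exp_rate[OF R(1)] wpos by auto
  show ?thesis
  proof (intro exI conjI allI impI)
    show "\<kappa> > 0" by fact
    fix n :: nat and \<alpha> :: real assume n: "n > 0"
    let ?P = "(2 * real n + 1)\<^sup>2"
    have "restricted_partition n \<alpha> \<gamma> far \<le> exp (\<bar>\<alpha>\<bar> * real n) * restricted_partition n 0 \<gamma> far"
      using restricted_partition_change_coupling[of n \<alpha> \<gamma> far 0] by simp
    also have "restricted_partition n 0 \<gamma> far \<le> ?P * (?w m * ?w m * exp (- \<kappa>)) ^ n"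
    proof (rule restricted_partition_le[OF n])
      show "0 \<le> ?w m * ?w m * exp (- \<kappa>)" using wpos[of m] by simp
      fix a b :: real assume ab: "(a, b) \<in> far" "\<bar>a\<bar> \<le> 1" "\<bar>b\<bar> \<le> 1"
      then show "?w a * ?w b * (cosh 0 + sinh 0 * (tanh (\<gamma> * a) * tanh (\<gamma> * b))) \<le> ?w m * ?w m * exp (- \<kappa>)"
        using R(2)[of "(a, b)"] \<kappa>(2) by (simp add: abs_le_iff)
    qed
    also have "(?w m * ?w m * exp (- \<kappa>)) ^ n = exp (- \<kappa> * real n) * (?w m * ?w m) ^ n"
      by (simp add: power_mult_distrib exp_of_nat_mult[symmetric] mult.commute)
    also have "(?w m * ?w m) ^ n \<le> restricted_partition n \<alpha> \<gamma> UNIV"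
      using \<open>\<gamma> > 1\<close> by (intro restricted_partition_UNIV_ge[OF n]) simp
    finally show "restricted_partition n \<alpha> \<gamma> far \<le>
        ?P * exp (\<bar>\<alpha>\<bar> * real n - \<kappa> * real n) * restricted_partition n \<alpha> \<gamma> UNIV"
      by (simp add: mult_left_mono exp_diff exp_minus field_simps)
  qed
qed

text \<open>With both blocks positively magnetized, the overlap \<open>X\<close> exceeds \<open>c * n\<close> outside an exponentially
  small set. On its bulk the antiferromagnetic factor \<open>exp (- \<alpha> * X)\<close> is at most \<open>exp (- c * n * \<alpha>)\<close>; on the exceptional set
  it is at most \<open>exp (\<alpha> * n)\<close>, which is subexponential when \<open>\<alpha> \<rightarrow> 0\<close>. The exceptional set is controlled by an exponential Markov
  inequality: \<open>\<theta>\<close> is a fixed antiferromagnetic coupling at which the pair factor of the product formula is smaller than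
  one.\<close>

lemma restricted_partition_antiferromagnetic_le:
  assumes "\<gamma> > 1"
  defines "Q \<equiv> {m_plus \<gamma> / 2..} \<times> {m_plus \<gamma> / 2..}"
  shows "\<exists>c>0. \<exists>\<kappa>>0. \<forall>n>0. \<forall>\<alpha>\<ge>0. restricted_partition n (- \<alpha>) \<gamma> Q \<le>
    (exp (- (c * (real n * \<alpha>))) + (2 * real n + 1)\<^sup>2 * exp (\<alpha> * real n - \<kappa> * real n)) * restricted_partition n \<alpha> \<gamma> UNIV"
proof -
  define m where "m = m_plus \<gamma>"
  let ?w = "site_weight \<gamma>"
  have m: "m > 0" unfolding m_def by (rule mean_field_equation_unimodal) fact
  have wpos: "?w y > 0" for y by (rule site_weight_pos)
  have wle: "?w y \<le> ?w m" for y unfolding m_def by (rule site_weight_le_max) fact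
  define s where "s = tanh (\<gamma> * (m / 2))"
  have s: "0 < s" "s < 1" using m assms by (auto simp: s_def tanh_real_lt_1)
  have "s * s < 1" using s mult_strict_mono[of s 1 s 1] by simp
  then obtain \<theta> where \<theta>: "\<theta> > 0" "cosh \<theta> - s * s * sinh \<theta> < 1"
    using cosh_minus_sinh_less_one[of "s * s"] s by auto
  obtain \<kappa> where \<kappa>: "\<kappa> > 0" "cosh \<theta> - s * s * sinh \<theta> \<le> exp (- \<kappa>)"
    using ex_exp_rate[OF \<theta>(2)] by auto
  \<comment> \<open>The Markov inequality costs \<open>exp (\<theta> * c * n)\<close>; this choice spends half of the rate \<open>\<kappa>\<close> on it.\<close>
  define c where "c = \<kappa> / (2 * \<theta>)"
  have c: "c > 0" "\<theta> * c = \<kappa> / 2" using \<kappa> \<theta> by (auto simp: c_def)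
  show ?thesis
  proof (rule exI[of _ c], intro conjI exI[of _ "\<kappa> / 2"] allI impI)
    show "c > 0" "\<kappa> / 2 > 0" using c \<kappa> by auto
    fix n :: nat and \<alpha> :: real assume n: "n > 0" and \<alpha>: "\<alpha> \<ge> 0"
    let ?P = "(2 * real n + 1)\<^sup>2"
    let ?Z = "restricted_partition n \<alpha> \<gamma> UNIV"
    have "restricted_partition n (- \<theta>) \<gamma> Q \<le> ?P * (?w m * ?w m * exp (- \<kappa>)) ^ n"
    proof (rule restricted_partition_le[OF n])
      show "0 \<le> ?w m * ?w m * exp (- \<kappa>)" using wpos[of m] by simp
      fix a b :: real assume ab: "(a, b) \<in> Q"
      have "s \<le> tanh (\<gamma> * a)" "s \<le> tanh (\<gamma> * b)"
        using ab assms unfolding s_def Q_def m_def by auto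
      then have "s * s \<le> tanh (\<gamma> * a) * tanh (\<gamma> * b)" using s by (intro mult_mono) linarith+
      then have "sinh \<theta> * (s * s) \<le> sinh \<theta> * (tanh (\<gamma> * a) * tanh (\<gamma> * b))"
        using \<theta> by (intro mult_left_mono) auto
      then have "cosh \<theta> - sinh \<theta> * (tanh (\<gamma> * a) * tanh (\<gamma> * b)) \<le> exp (- \<kappa>)"
        using \<kappa>(2) by (simp add: mult.commute)
      moreover have "?w a * ?w b \<le> ?w m * ?w m" using wle less_imp_le[OF wpos] by (intro mult_mono)
      ultimately have "?w a * ?w b * (cosh \<theta> - sinh \<theta> * (tanh (\<gamma> * a) * tanh (\<gamma> * b))) \<le>
          ?w m * ?w m * exp (- \<kappa>)"
        using wpos
        by (meson exp_ge_zero less_imp_le mult_left_mono mult_pos_pos mult_right_mono order_trans)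
      then show "?w a * ?w b * (cosh (- \<theta>) + sinh (- \<theta>) * (tanh (\<gamma> * a) * tanh (\<gamma> * b))) \<le>
          ?w m * ?w m * exp (- \<kappa>)" by simp
    qed
    also have "\<dots> = ?P * exp (- \<kappa> * real n) * (?w m * ?w m) ^ n"
      by (simp add: power_mult_distrib exp_of_nat_mult[symmetric] mult.commute)
    also have "\<dots> \<le> ?P * exp (- \<kappa> * real n) * ?Z"
      using \<open>\<gamma> > 1\<close> by (intro mult_left_mono restricted_partition_UNIV_ge[OF n]) auto
    finally have small: "restricted_partition n (- \<theta>) \<gamma> Q \<le> ?P * exp (- \<kappa> * real n) * ?Z" .
    have "restricted_partition n (- \<alpha>) \<gamma> Q \<le>
        exp (- (c * (n * \<alpha>))) * restricted_partition n 0 \<gamma> Q + exp (\<alpha> * real n + \<theta> * c * real n) * restricted_partition n (- \<theta>) \<gamma> Q"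
      unfolding restricted_partition_def sum_distrib_left sum.distrib[symmetric]
    proof (rule sum_mono)
      fix \<sigma> assume "\<sigma> \<in> {\<sigma> \<in> configs (2 * n). block_magnetization (2 * n) \<sigma> \<in> Q}"
      then have X: "\<bar>overlap (2 * n) \<sigma>\<bar> \<le> real n" by (intro abs_overlap_le) auto
      let ?X = "overlap (2 * n) \<sigma>"
      have "exp (- \<alpha> * ?X) \<le> exp (- (c * (n * \<alpha>))) + exp (\<alpha> * real n + \<theta> * c * real n) * exp (- \<theta> * ?X)"
      proof (cases "?X \<ge> c * real n")
        case True
        then have "\<alpha> * (c * real n) \<le> \<alpha> * ?X" using \<alpha> by (rule mult_left_mono)
        then have "exp (- \<alpha> * ?X) \<le> exp (- (c * (n * \<alpha>)))" by (simp add: mult_ac)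
        then show ?thesis by (intro add_increasing2) simp_all
      next
        case False
        then have "\<theta> * ?X \<le> \<theta> * (c * real n)" using \<theta> by (intro mult_left_mono) auto
        moreover have "\<alpha> * (- ?X) \<le> \<alpha> * real n" using X \<alpha> by (intro mult_left_mono) auto
        ultimately have "exp (- \<alpha> * ?X) \<le> exp (\<alpha> * real n + \<theta> * c * real n + - \<theta> * ?X)" by simp
        then show ?thesis unfolding exp_add by (rule add_increasing[OF exp_ge_zero])
      qed
      from mult_left_mono[OF this, of "exp (- hamiltonian (2 * n) 0 (2 * \<gamma>) \<sigma>)"]
      show "exp (- hamiltonian (2 * n) (- \<alpha>) (2 * \<gamma>) \<sigma>) \<le>
          exp (- (c * (n * \<alpha>))) * exp (- hamiltonian (2 * n) 0 (2 * \<gamma>) \<sigma>) +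
          exp (\<alpha> * real n + \<theta> * c * real n) * exp (- hamiltonian (2 * n) (- \<theta>) (2 * \<gamma>) \<sigma>)"
        unfolding exp_minus_hamiltonian_shift[of "2 * n" "- \<alpha>" _ _ 0]
          exp_minus_hamiltonian_shift[of "2 * n" "- \<theta>" _ _ 0]
        by (simp add: distrib_left mult_ac)
    qed
    also have "restricted_partition n 0 \<gamma> Q \<le> ?Z"
      using restricted_partition_mono[of Q UNIV] restricted_partition_UNIV_ge_uncoupled by (meson order_trans subset_UNIV)
    also note small
    also have "exp (\<alpha> * real n + \<theta> * c * real n) * (?P * exp (- \<kappa> * real n) * ?Z) = ?P * exp (\<alpha> * real n - \<kappa> / 2 * real n) * ?Z"
    proof -
      have "exp (\<alpha> * real n + \<theta> * c * real n) * exp (- \<kappa> * real n) = exp (\<alpha> * real n - \<kappa> / 2 * real n)"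
        unfolding c(2) by (simp add: exp_add[symmetric] field_simps)
      then show ?thesis by (simp add: mult_ac)
    qed
    finally show "restricted_partition n (- \<alpha>) \<gamma> Q \<le>
        (exp (- (c * (real n * \<alpha>))) + ?P * exp (\<alpha> * real n - \<kappa> / 2 * real n)) * ?Z"
      by (simp add: distrib_right mult_left_mono)
  qed
qed

lemma polynomial_times_exp_tendsto_0:
  fixes a :: "nat \<Rightarrow> real" and \<kappa> :: real
  assumes "a \<longlonglongrightarrow> 0" and "\<kappa> > 0"
  shows "(\<lambda>n. (2 * real n + 1)\<^sup>2 * exp (a n * real n - \<kappa> * real n)) \<longlonglongrightarrow> 0"
proof (rule tendsto_sandwich[OF _ _ tendsto_const])
  let ?x = "exp (- \<kappa> / 4)"
  have x: "norm ?x < 1" using assms by simp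
  have "(2 * (real n * ?x ^ n) + ?x ^ n)\<^sup>2 = (2 * real n + 1)\<^sup>2 * exp (- (\<kappa> / 2) * real n)" for n
  proof -
    have "(?x ^ n)\<^sup>2 = exp (- (\<kappa> / 2) * real n)"
      by (simp add: exp_of_nat_mult[symmetric] power2_eq_square exp_add[symmetric])
    then show ?thesis
      by (metis (no_types, lifting) distrib_right mult.assoc mult_1 power_mult_distrib)
  qed
  moreover have "(\<lambda>n. (2 * (real n * ?x ^ n) + ?x ^ n)\<^sup>2) \<longlonglongrightarrow> (2 * 0 + 0)\<^sup>2"
    by (intro tendsto_intros powser_times_n_limit_0 LIMSEQ_power_zero x)
  ultimately show "(\<lambda>n. (2 * real n + 1)\<^sup>2 * exp (- (\<kappa> / 2) * real n)) \<longlonglongrightarrow> 0"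
    by simp
  have "\<forall>\<^sub>F n in sequentially. a n < \<kappa> / 2" using assms by (intro order_tendstoD) auto
  then show "\<forall>\<^sub>F n in sequentially. (2 * real n + 1)\<^sup>2 * exp (a n * real n - \<kappa> * real n) \<le>
      (2 * real n + 1)\<^sup>2 * exp (- (\<kappa> / 2) * real n)"
  proof eventually_elim
    case (elim n)
    then have "a n * real n \<le> \<kappa> / 2 * real n" by (intro mult_right_mono) auto
    then show ?case by (intro mult_left_mono) (auto simp: field_simps)
  qed
qed auto

section \<open>Weak convergence to a finitely supported law\<close>

text \<open>On the balls the function is replaced by its value at the centre, and off the balls by zero; the error on the
  complement is at most the bound \<open>B\<close> times the missing mass.\<close>

lemma integral_near_finite_sum:
  fixes f :: "'a::{metric_space, second_countable_topology} \<Rightarrow> real"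
  assumes "prob_space P" and P: "sets P = sets borel"
    and f: "f \<in> borel_measurable borel" "\<And>x. \<bar>f x\<bar> \<le> B"
    and "finite C" and disj: "disjoint_family_on (\<lambda>c. ball c \<epsilon>) C"
    and near: "\<And>c x. c \<in> C \<Longrightarrow> x \<in> ball c \<epsilon> \<Longrightarrow> \<bar>f x - f c\<bar> \<le> \<delta>" and "\<delta> \<ge> 0"
  shows "\<bar>(\<integral>x. f x \<partial>P) - (\<Sum>c\<in>C. measure P (ball c \<epsilon>) * f c)\<bar>
    \<le> \<delta> + B * (1 - (\<Sum>c\<in>C. measure P (ball c \<epsilon>)))"
proof -
  interpret prob_space P by fact
  note [measurable_cong] = P
  note [measurable] = f(1)
  let ?s = "\<lambda>x. \<Sum>c\<in>C. indicator (ball c \<epsilon>) x * f c"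
  let ?i = "\<lambda>x. \<Sum>c\<in>C. indicat_real (ball c \<epsilon>) x"
  have [measurable]: "ball c \<epsilon> \<in> sets P" for c unfolding P by simp
  have int [simp]: "integrable P (\<lambda>x. indicat_real (ball c \<epsilon>) x)" for c
    by (rule integrable_const_bound[of _ 1]) (auto simp: indicator_def)
  have int_f: "integrable P f" by (rule integrable_const_bound[of _ B]) (auto simp: f P)
  have "(\<integral>x. f x \<partial>P) - (\<Sum>c\<in>C. measure P (ball c \<epsilon>) * f c) = (\<integral>x. f x - ?s x \<partial>P)"
    using int_f by simp
  also have "\<bar>\<dots>\<bar> \<le> (\<integral>x. \<delta> + B * (1 - ?i x) \<partial>P)"
  proof (rule order_trans[OF integral_abs_bound integral_mono])
    show "integrable P (\<lambda>x. \<bar>f x - ?s x\<bar>)" using int_f by simp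
    show "integrable P (\<lambda>x. \<delta> + B * (1 - ?i x))" by simp
    fix x
    show "\<bar>f x - ?s x\<bar> \<le> \<delta> + B * (1 - ?i x)"
    proof (cases "\<exists>c\<in>C. x \<in> ball c \<epsilon>")
      case True
      then obtain c where c: "c \<in> C" "x \<in> ball c \<epsilon>" by blast
      have ind: "indicat_real (ball d \<epsilon>) x = (if d = c then 1 else 0)" if "d \<in> C" for d
        using disjoint_family_onD[OF disj that c(1)] c(2)
        by (cases "d = c") (auto simp: indicator_def disjoint_iff)
      have "?s x = (\<Sum>d\<in>C. if d = c then f c else 0)" by (intro sum.cong) (auto simp: ind)
      moreover have "?i x = (\<Sum>d\<in>C. if d = c then 1 else 0)" by (intro sum.cong) (auto simp: ind)
      ultimately have "?s x = f c" "?i x = 1" using \<open>finite C\<close> c by simp_all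
      then show ?thesis using near[OF c] by simp
    next
      case False
      then have "?s x = 0" "?i x = 0" by (auto intro!: sum.neutral simp: indicator_def)
      then show ?thesis using f(2)[of x] \<open>\<delta> \<ge> 0\<close> by simp
    qed
  qed
  also have "\<dots> = \<delta> + B * (1 - (\<Sum>c\<in>C. measure P (ball c \<epsilon>)))"
    by (simp add: prob_space)
  finally show ?thesis .
qed

lemma disjoint_family_on_ball_mono:
  assumes "disjoint_family_on (\<lambda>c. ball c r) C" and "\<epsilon> \<le> r"
  shows "disjoint_family_on (\<lambda>c. ball c \<epsilon>) C"
  unfolding disjoint_family_on_def
proof (intro ballI impI)
  fix c d assume "c \<in> C" "d \<in> C" "c \<noteq> d"
  from disjoint_family_onD[OF assms(1) this] show "ball c \<epsilon> \<inter> ball d \<epsilon> = {}"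
    using subset_ball[OF assms(2)] by (meson disjoint_iff subsetD)
qed

text \<open>By the preceding estimate, applied to \<open>M i\<close> and to \<open>L\<close>, the integral of a test function depends, up to a small
  error, only on the masses of small balls around the points of \<open>C\<close>.\<close>

lemma weakly_converges_finite_support:
  fixes L :: "'a::{metric_space, second_countable_topology} measure"
  assumes M: "\<And>i. prob_space (M i)" "\<And>i. sets (M i) = sets borel"
    and L: "prob_space L" "sets L = sets borel"
    and C: "finite C" "measure L C = 1"
    and "\<epsilon>\<^sub>0 > 0" and disj: "disjoint_family_on (\<lambda>c. ball c \<epsilon>\<^sub>0) C"
    and lim: "\<And>c \<epsilon>. c \<in> C \<Longrightarrow> 0 < \<epsilon> \<Longrightarrow> \<epsilon> < \<epsilon>\<^sub>0 \<Longrightarrow>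
      ((\<lambda>i. measure (M i) (ball c \<epsilon>)) \<longlongrightarrow> measure L (ball c \<epsilon>)) F"
  shows "weakly_converges M L F"
  unfolding weakly_converges_def
proof (intro allI impI tendstoI)
  fix f :: "'a \<Rightarrow> real" and e :: real
  assume f: "continuous_on UNIV f" "bounded (range f)" and "e > 0"
  interpret L: prob_space L by fact
  have [measurable]: "f \<in> borel_measurable borel" by (rule borel_measurable_continuous_onI) fact
  obtain B where B: "\<And>x. \<bar>f x\<bar> \<le> B" using f(2) by (auto simp: bounded_iff)
  have "\<exists>d>0. \<forall>x. dist x c < d \<longrightarrow> dist (f x) (f c) < e / 3" for c
    using f(1) \<open>e > 0\<close> unfolding continuous_on_iff by (metis UNIV_I zero_less_divide_iff zero_less_numeral)
  then obtain d where d: "\<And>c. d c > 0" "\<And>c x. dist x c < d c \<Longrightarrow> dist (f x) (f c) < e / 3"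
    by metis
  \<comment> \<open>The radius is chosen below \<open>\<epsilon>\<^sub>0\<close> and so small that \<open>f\<close> is nearly constant on each ball.\<close>
  define \<epsilon> where "\<epsilon> = Min (insert (\<epsilon>\<^sub>0 / 2) (d ` C))"
  have \<epsilon>: "0 < \<epsilon>" "\<epsilon> < \<epsilon>\<^sub>0" "\<And>c. c \<in> C \<Longrightarrow> \<epsilon> \<le> d c"
    using C(1) \<open>\<epsilon>\<^sub>0 > 0\<close> d(1) by (auto simp: \<epsilon>_def Min_less_iff)
  have disj': "disjoint_family_on (\<lambda>c. ball c \<epsilon>) C"
    by (rule disjoint_family_on_ball_mono[OF disj less_imp_le[OF \<epsilon>(2)]])
  have near: "\<bar>f x - f c\<bar> \<le> e / 3" if "c \<in> C" "x \<in> ball c \<epsilon>" for c x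
    using d(2)[of x c] \<epsilon>(3)[OF that(1)] that(2)
    by (simp add: dist_commute[of c] dist_real_def)
  let ?est = "\<lambda>P. e / 3 + B * (1 - (\<Sum>c\<in>C. measure P (ball c \<epsilon>)))"
  let ?S = "\<lambda>P. \<Sum>c\<in>C. measure P (ball c \<epsilon>) * f c"
  have est: "\<bar>(\<integral>x. f x \<partial>P) - ?S P\<bar> \<le> ?est P" if "prob_space P" "sets P = sets borel" for P
  proof (rule integral_near_finite_sum[OF that(1) that(2) _ B C(1) disj'])
    show "f \<in> borel_measurable borel" by measurable
    show "e / 3 \<ge> 0" using \<open>e > 0\<close> by simp
  qed (rule near)
  have full: "(\<Sum>c\<in>C. measure L (ball c \<epsilon>)) = 1"
  proof -
    have "(\<Sum>c\<in>C. measure L (ball c \<epsilon>)) = measure L (\<Union>c\<in>C. ball c \<epsilon>)"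
      by (rule L.finite_measure_finite_Union[OF C(1) _ disj', symmetric]) (auto simp: L(2))
    moreover have "measure L C \<le> measure L (\<Union>c\<in>C. ball c \<epsilon>)"
    proof (rule L.finite_measure_mono)
      show "C \<subseteq> (\<Union>c\<in>C. ball c \<epsilon>)" using \<epsilon>(1) by auto
      show "(\<Union>c\<in>C. ball c \<epsilon>) \<in> sets L" unfolding L(2) by (intro borel_open open_UN ballI open_ball)
    qed
    moreover have "measure L (\<Union>c\<in>C. ball c \<epsilon>) \<le> 1" by (rule L.prob_le_1)
    ultimately show ?thesis using C(2) by linarith
  qed
  have "((\<lambda>i. ?est (M i) + \<bar>?S (M i) - ?S L\<bar> + ?est L) \<longlongrightarrow> ?est L + \<bar>?S L - ?S L\<bar> + ?est L) F"
    by (intro tendsto_intros lim \<epsilon>)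
  from order_tendstoD(2)[OF this, of e]
  have "\<forall>\<^sub>F i in F. ?est (M i) + \<bar>?S (M i) - ?S L\<bar> + ?est L < e"
    using \<open>e > 0\<close> by (simp add: full)
  then show "\<forall>\<^sub>F i in F. dist (\<integral>x. f x \<partial>M i) (\<integral>x. f x \<partial>L) < e"
  proof (rule eventually_mono)
    fix i assume less: "?est (M i) + \<bar>?S (M i) - ?S L\<bar> + ?est L < e"
    have triangle: "\<bar>a - c\<bar> < e" if "\<bar>a - u\<bar> \<le> p" "\<bar>c - v\<bar> \<le> q" "p + \<bar>u - v\<bar> + q < e"
      for a c u v p q :: real using that by linarith
    show "dist (\<integral>x. f x \<partial>M i) (\<integral>x. f x \<partial>L) < e"
      unfolding dist_real_def by (rule triangle[OF est[OF M(1) M(2)] est[OF L] less])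
  qed
qed

section \<open>Masses of the four corners and the limit theorem\<close>

lemma vimage_uminus_ball: "uminus -` ball c \<epsilon> = ball (- c :: 'a::real_normed_vector) \<epsilon>"
  by (auto simp: dist_norm) (metis norm_minus_commute add.commute diff_minus_eq_add minus_diff_commute)+

lemma measure_law_ball_minus:
  "measure (magnetization_law (2 * n) \<alpha> (2 * \<gamma>)) (ball (- c) \<epsilon>) =
   measure (magnetization_law (2 * n) \<alpha> (2 * \<gamma>)) (ball c \<epsilon>)"
  using restricted_partition_flip_all[of n \<alpha> \<gamma> "ball c \<epsilon>"]
  by (simp add: measure_magnetization_law vimage_uminus_ball)

lemma measure_law_ball_reflect:
  "measure (magnetization_law (2 * n) \<alpha> (2 * \<gamma>)) (ball (x, - y) \<epsilon>) =
   restricted_partition n (- \<alpha>) \<gamma> (ball (x, y) \<epsilon>) / restricted_partition n \<alpha> \<gamma> UNIV"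
proof -
  have "dist (- y) w = dist y (- w)" for w :: real by (simp add: dist_real_def)
  then have "(\<lambda>(x, y). (x, - y)) -` ball (x, - y) \<epsilon> = ball (x, y) \<epsilon>" by (auto simp: dist_Pair_Pair)
  then show ?thesis
    using restricted_partition_flip_block2[of n \<alpha> \<gamma> "ball (x, - y) \<epsilon>"] by (simp add: measure_magnetization_law)
qed

text \<open>By the global flip opposite corners have the same mass, so two numbers describe the four masses.\<close>

lemma measure_law_corners:
  fixes n :: nat and \<alpha> \<gamma> m \<epsilon> :: real
  assumes "\<epsilon> > 0" "\<epsilon> \<le> m"
  defines "P \<equiv> magnetization_law (2 * n) \<alpha> (2 * \<gamma>)"
  shows "2 * measure P (ball (m, m) \<epsilon>) + 2 * measure P (ball (m, - m) \<epsilon>) +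
    measure P (- (\<Union>c\<in>corners m. ball c \<epsilon>)) = 1"
proof -
  interpret P: prob_space P unfolding P_def by (rule prob_space_magnetization_law)
  have sets: "sets P = sets borel" by (simp add: P_def magnetization_law_def)
  have space: "space P = UNIV" by (simp add: P_def magnetization_law_def)
  let ?U = "\<Union>c\<in>corners m. ball c \<epsilon>"
  have U: "?U \<in> sets P" unfolding sets by (intro borel_open open_UN ballI open_ball)
  have disj: "disjoint_family_on (\<lambda>c. ball c \<epsilon>) (corners m)"
    by (rule disjoint_family_on_ball_mono[OF corners_disjoint assms(2)])
  have "measure P ?U = (\<Sum>c\<in>corners m. measure P (ball c \<epsilon>))"
    by (rule P.finite_measure_finite_Union[OF _ _ disj]) (auto simp: corners_def sets)
  also have "\<dots> = measure P (ball (m, m) \<epsilon>) + measure P (ball (m, - m) \<epsilon>) +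
      (measure P (ball (- m, m) \<epsilon>) + measure P (ball (- m, - m) \<epsilon>))"
    using assms by (simp add: corners_def sum.cartesian_product[symmetric])
  also have "measure P (ball (- m, m) \<epsilon>) = measure P (ball (m, - m) \<epsilon>)"
    using measure_law_ball_minus[of n \<alpha> \<gamma> "(m, - m)"] by (simp add: P_def)
  also have "measure P (ball (- m, - m) \<epsilon>) = measure P (ball (m, m) \<epsilon>)"
    using measure_law_ball_minus[of n \<alpha> \<gamma> "(m, m)"] by (simp add: P_def)
  finally have "measure P ?U = 2 * measure P (ball (m, m) \<epsilon>) + 2 * measure P (ball (m, - m) \<epsilon>)" by simp
  moreover have "measure P (- ?U) = 1 - measure P ?U"
    using P.prob_compl[OF U] by (simp add: space Compl_eq_Diff_UNIV)
  ultimately show ?thesis by simp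
qed

lemma restricted_partition_UNIV_pos: "0 < restricted_partition n \<alpha> \<gamma> UNIV"
  by (simp add: restricted_partition_UNIV partition_function_pos)

lemma far_probability_tendsto_0:
  assumes "\<gamma> > 1" "\<epsilon> > 0" and a: "a \<longlonglongrightarrow> 0"
  shows "(\<lambda>n. measure (magnetization_law (2 * n) (a n) (2 * \<gamma>))
    (- (\<Union>c\<in>corners (m_plus \<gamma>). ball c \<epsilon>))) \<longlonglongrightarrow> 0"
proof -
  define far where "far = - (\<Union>c\<in>corners (m_plus \<gamma>). ball c \<epsilon>)"
  obtain \<kappa> where \<kappa>: "\<kappa> > 0" "\<And>n \<alpha>. n > 0 \<Longrightarrow> restricted_partition n \<alpha> \<gamma> far \<le>
    (2 * real n + 1)\<^sup>2 * exp (\<bar>\<alpha>\<bar> * real n - \<kappa> * real n) * restricted_partition n \<alpha> \<gamma> UNIV"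
    using restricted_partition_far_le[OF assms(1,2)] unfolding far_def by blast
  have meas: "far \<in> sets borel" unfolding far_def by (intro borel_closed closed_Compl open_UN ballI open_ball)
  show ?thesis unfolding far_def[symmetric]
  proof (rule tendsto_sandwich[OF _ _ tendsto_const])
    show "(\<lambda>n. (2 * real n + 1)\<^sup>2 * exp (\<bar>a n\<bar> * real n - \<kappa> * real n)) \<longlonglongrightarrow> 0"
      using a by (intro polynomial_times_exp_tendsto_0 tendsto_rabs_zero \<kappa>)
    show "\<forall>\<^sub>F n in sequentially. measure (magnetization_law (2 * n) (a n) (2 * \<gamma>)) far \<le>
        (2 * real n + 1)\<^sup>2 * exp (\<bar>a n\<bar> * real n - \<kappa> * real n)"
      using eventually_gt_at_top[of 0]
      by eventually_elim
        (use \<kappa>(2) in \<open>simp add: measure_magnetization_law[OF meas] divide_le_eq restricted_partition_UNIV_pos\<close>)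
  qed auto
qed

text \<open>The mass at \<open>(m\<^sup>+, m\<^sup>-)\<close> is an antiferromagnetic restricted partition function at \<open>(m\<^sup>+, m\<^sup>+)\<close> and hence
  vanishes in the limit. The radius is at most \<open>m\<^sup>+ / 2\<close> so that the ball lies in the quadrant of that bound.\<close>

lemma corner_probabilities_strong_coupling:
  assumes "\<gamma> > 1" and a: "a \<longlonglongrightarrow> 0" "\<And>n. n > 0 \<Longrightarrow> a n \<ge> 0"
    and na: "filterlim (\<lambda>n. real n * a n) at_top sequentially"
    and \<epsilon>: "0 < \<epsilon>" "\<epsilon> \<le> m_plus \<gamma> / 2"
  shows "(\<lambda>n. measure (magnetization_law (2 * n) (a n) (2 * \<gamma>)) (ball (m_plus \<gamma>, m_plus \<gamma>) \<epsilon>)) \<longlonglongrightarrow> 1 / 2"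
proof -
  define m where "m = m_plus \<gamma>"
  let ?P = "\<lambda>n. magnetization_law (2 * n) (a n) (2 * \<gamma>)"
  let ?Q = "{m_plus \<gamma> / 2..} \<times> {m_plus \<gamma> / 2..}"
  define far where "far = - (\<Union>c\<in>corners m. ball c \<epsilon>)"
  obtain c \<kappa> where c: "c > 0" and \<kappa>: "\<kappa> > 0" and bound: "\<And>n \<alpha>. n > 0 \<Longrightarrow> \<alpha> \<ge> 0 \<Longrightarrow> restricted_partition n (- \<alpha>) \<gamma> ?Q \<le>
    (exp (- (c * (real n * \<alpha>))) + (2 * real n + 1)\<^sup>2 * exp (\<alpha> * real n - \<kappa> * real n)) * restricted_partition n \<alpha> \<gamma> UNIV"
    using restricted_partition_antiferromagnetic_le[OF assms(1)] by blast
  have "ball (m, m) \<epsilon> \<subseteq> ?Q"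
  proof (rule subsetI)
    fix p assume p: "p \<in> ball (m, m) \<epsilon>"
    have "dist m (fst p) < \<epsilon>" "dist m (snd p) < \<epsilon>"
      using p dist_fst_le[of "(m, m)" p] dist_snd_le[of "(m, m)" p] by auto
    then show "p \<in> ?Q" using \<epsilon>(2) unfolding m_def dist_real_def by (cases p) auto
  qed
  note mono = restricted_partition_mono[OF this]
  have "(\<lambda>n. measure (?P n) (ball (m, - m) \<epsilon>)) \<longlonglongrightarrow> 0"
  proof (rule tendsto_sandwich[OF _ _ tendsto_const])
    have "filterlim (\<lambda>n. c * (real n * a n)) at_top sequentially"
      using na c by (simp add: filterlim_tendsto_pos_mult_at_top[OF tendsto_const])
    then have "(\<lambda>n. exp (- (c * (real n * a n)))) \<longlonglongrightarrow> 0"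
      by (intro filterlim_compose[OF exp_at_bot]) (simp add: filterlim_uminus_at_top[symmetric])
    from tendsto_add[OF this polynomial_times_exp_tendsto_0[OF a(1) \<kappa>]]
    show "(\<lambda>n. exp (- (c * (real n * a n))) + (2 * real n + 1)\<^sup>2 * exp (a n * real n - \<kappa> * real n)) \<longlonglongrightarrow> 0"
      by simp
    show "\<forall>\<^sub>F n in sequentially. measure (?P n) (ball (m, - m) \<epsilon>) \<le>
        exp (- (c * (real n * a n))) + (2 * real n + 1)\<^sup>2 * exp (a n * real n - \<kappa> * real n)"
      using eventually_gt_at_top[of 0]
    proof eventually_elim
      case (elim n)
      from order_trans[OF mono bound[OF elim a(2)[OF elim]]] show ?case
        unfolding measure_law_ball_reflect by (simp add: divide_le_eq restricted_partition_UNIV_pos)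
    qed
  qed auto
  moreover have "(\<lambda>n. measure (?P n) far) \<longlonglongrightarrow> 0"
    unfolding m_def far_def by (rule far_probability_tendsto_0[OF \<open>\<gamma> > 1\<close> \<epsilon>(1) a(1)])
  ultimately have lim: "(\<lambda>n. (1 - 2 * measure (?P n) (ball (m, - m) \<epsilon>) - measure (?P n) far) / 2)
      \<longlonglongrightarrow> (1 - 2 * 0 - 0) / 2"
    by (intro tendsto_intros) auto
  have eq: "measure (?P n) (ball (m, m) \<epsilon>) =
      (1 - 2 * measure (?P n) (ball (m, - m) \<epsilon>) - measure (?P n) far) / 2" for n
    using measure_law_corners[of \<epsilon> m n "a n" \<gamma>] \<epsilon> unfolding m_def far_def by simp
  show ?thesis using lim unfolding m_def[symmetric] eq by simp
qed

text \<open>Changing \<open>\<alpha>\<close> to \<open>- \<alpha>\<close> changes all weights by factors between \<open>exp (- 2 * n * \<bar>\<alpha>\<bar>)\<close> and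
  \<open>exp (2 * n * \<bar>\<alpha>\<bar>)\<close>, so the masses at \<open>(m\<^sup>+, m\<^sup>+)\<close> and \<open>(m\<^sup>+, m\<^sup>-)\<close> have the same limit.\<close>

lemma corner_probabilities_weak_coupling:
  assumes "\<gamma> > 1" and na: "(\<lambda>n. real n * a n) \<longlonglongrightarrow> 0" and a: "a \<longlonglongrightarrow> 0"
    and \<epsilon>: "0 < \<epsilon>" "\<epsilon> \<le> m_plus \<gamma>"
  shows "(\<lambda>n. measure (magnetization_law (2 * n) (a n) (2 * \<gamma>)) (ball (m_plus \<gamma>, m_plus \<gamma>) \<epsilon>)) \<longlonglongrightarrow> 1 / 4"
    and "(\<lambda>n. measure (magnetization_law (2 * n) (a n) (2 * \<gamma>)) (ball (m_plus \<gamma>, - m_plus \<gamma>) \<epsilon>)) \<longlonglongrightarrow> 1 / 4"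
proof -
  define m where "m = m_plus \<gamma>"
  let ?P = "\<lambda>n. magnetization_law (2 * n) (a n) (2 * \<gamma>)"
  let ?far = "- (\<Union>c\<in>corners m. ball c \<epsilon>)"
  let ?u = "\<lambda>n. measure (?P n) (ball (m, m) \<epsilon>)"
  let ?v = "\<lambda>n. measure (?P n) (ball (m, - m) \<epsilon>)"
  let ?e = "\<lambda>n. exp (2 * \<bar>real n * a n\<bar>) - 1"
  have close: "\<bar>?u n - ?v n\<bar> \<le> ?e n" for n
  proof -
    let ?G = "\<lambda>\<alpha>. restricted_partition n \<alpha> \<gamma> (ball (m, m) \<epsilon>)" and ?Z = "restricted_partition n (a n) \<gamma> UNIV"
    have u: "?u n = ?G (a n) / ?Z" by (simp add: measure_magnetization_law)
    have v: "?v n = ?G (- a n) / ?Z" by (rule measure_law_ball_reflect)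
    have exps: "\<bar>a n - - a n\<bar> * real n = 2 * \<bar>real n * a n\<bar>" "\<bar>- a n - a n\<bar> * real n = 2 * \<bar>real n * a n\<bar>"
      by (simp_all add: abs_mult abs_minus_commute[of "- a n"] flip: mult_2)
    have "?u n \<le> (?e n + 1) * ?v n" "?v n \<le> (?e n + 1) * ?u n"
      using restricted_partition_change_coupling[of n "a n" \<gamma> "ball (m, m) \<epsilon>" "- a n"]
        restricted_partition_change_coupling[of n "- a n" \<gamma> "ball (m, m) \<epsilon>" "a n"] restricted_partition_UNIV_pos[of n "a n" \<gamma>]
      unfolding u v exps by (simp_all add: divide_right_mono)
    moreover have "?u n \<le> 1" "?v n \<le> 1"
      using prob_space.prob_le_1[OF prob_space_magnetization_law] by auto
    then have "?e n * ?u n \<le> ?e n" "?e n * ?v n \<le> ?e n" by (simp_all add: mult_left_le)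
    ultimately show ?thesis by (simp add: algebra_simps abs_le_iff)
  qed
  have "?e \<longlonglongrightarrow> exp (2 * \<bar>0\<bar>) - 1" by (intro tendsto_intros na)
  then have e0: "?e \<longlonglongrightarrow> 0" by simp
  have "\<forall>\<^sub>F n in sequentially. norm (?u n - ?v n) \<le> ?e n"
    using close by (intro always_eventually allI) (simp only: real_norm_def)
  from Lim_null_comparison[OF this e0] have diff: "(\<lambda>n. ?u n - ?v n) \<longlonglongrightarrow> 0" .
  have far: "(\<lambda>n. measure (?P n) ?far) \<longlonglongrightarrow> 0"
    unfolding m_def by (rule far_probability_tendsto_0[OF \<open>\<gamma> > 1\<close> \<epsilon>(1) a])
  have total: "2 * ?u n + 2 * ?v n + measure (?P n) ?far = 1" for n
    using measure_law_corners[of \<epsilon> m n "a n" \<gamma>] \<epsilon> by (simp add: m_def)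
  have solve: "(1 - z + 2 * (x - y)) / 4 = x" "(1 - z - 2 * (x - y)) / 4 = y"
    if "2 * x + 2 * y + z = 1" for x y z :: real
    using that by auto
  note u_eq = solve(1)[OF total] and v_eq = solve(2)[OF total]
  have "(\<lambda>n. (1 - measure (?P n) ?far + 2 * (?u n - ?v n)) / 4) \<longlonglongrightarrow> (1 - 0 + 2 * 0) / 4"
    by (intro tendsto_intros far diff) simp
  then show "(\<lambda>n. measure (?P n) (ball (m_plus \<gamma>, m_plus \<gamma>) \<epsilon>)) \<longlonglongrightarrow> 1 / 4"
    unfolding u_eq unfolding m_def by simp
  have "(\<lambda>n. (1 - measure (?P n) ?far - 2 * (?u n - ?v n)) / 4) \<longlonglongrightarrow> (1 - 0 - 2 * 0) / 4"
    by (intro tendsto_intros far diff) simp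
  then show "(\<lambda>n. measure (?P n) (ball (m_plus \<gamma>, - m_plus \<gamma>) \<epsilon>)) \<longlonglongrightarrow> 1 / 4"
    unfolding v_eq unfolding m_def by simp
qed

lemma emeasure_two_diracs:
  fixes a b :: "'a::topological_space"
  assumes "A \<in> sets borel"
  shows "emeasure (scale_measure (1 / 2) (dirac a +\<^sub>M dirac b)) A =
    ennreal ((indicator A a + indicator A b) / 2)"
proof -
  have "emeasure (scale_measure (1 / 2) (dirac a +\<^sub>M dirac b)) A =
      (1 / 2) * (indicator A a + indicator A b)"
    using assms by (simp add: emeasure_add_measure)
  also have "\<dots> =
      ennreal (1 / 2) * ennreal (indicator A a + indicator A b)"
    using divide_ennreal[of 1 2] by (simp add: ennreal_indicator)
  also have "\<dots> = ennreal ((indicator A a + indicator A b) / 2)"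
    by (subst ennreal_mult'[symmetric]) simp_all
  finally show ?thesis .
qed

lemma emeasure_four_diracs:
  fixes a b c d :: "'a::topological_space"
  assumes "A \<in> sets borel"
  shows "emeasure (scale_measure (1 / 4) (dirac a +\<^sub>M dirac b +\<^sub>M dirac c +\<^sub>M dirac d)) A =
    ennreal ((indicator A a + indicator A b + indicator A c + indicator A d) / 4)"
proof -
  have "emeasure (scale_measure (1 / 4) (dirac a +\<^sub>M dirac b +\<^sub>M dirac c +\<^sub>M dirac d)) A =
      (1 / 4) * (indicator A a + indicator A b + indicator A c + indicator A d)"
    using assms by (simp add: emeasure_add_measure)
  also have "\<dots> =
      ennreal (1 / 4) * ennreal (indicator A a + indicator A b + indicator A c + indicator A d)"
    using divide_ennreal[of 1 4] by (simp add: ennreal_indicator)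
  also have "\<dots> = ennreal ((indicator A a + indicator A b + indicator A c + indicator A d) / 4)"
    by (subst ennreal_mult'[symmetric]) simp_all
  finally show ?thesis .
qed

text \<open>Limits along even \<open>N\<close> are limits along the block size.\<close>

lemma even_at_top_eq: "even_at_top = filtermap (\<lambda>n. 2 * n) sequentially"
proof (rule antisym; rule filter_leI)
  fix P :: "nat \<Rightarrow> bool"
  assume "eventually P (filtermap (\<lambda>n. 2 * n) sequentially)"
  then obtain n\<^sub>0 where "\<And>n. n \<ge> n\<^sub>0 \<Longrightarrow> P (2 * n)"
    by (auto simp: eventually_filtermap eventually_sequentially)
  then have "P N" if "N \<ge> 2 * n\<^sub>0" "even N" for N using that by (auto elim!: evenE)
  then show "eventually P even_at_top"
    unfolding even_at_top_def eventually_inf_principal eventually_sequentially by blast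
next
  fix P :: "nat \<Rightarrow> bool"
  assume "eventually P even_at_top"
  then obtain N\<^sub>0 where "\<And>N. N \<ge> N\<^sub>0 \<Longrightarrow> even N \<Longrightarrow> P N"
    unfolding even_at_top_def eventually_inf_principal eventually_sequentially by auto
  then show "eventually P (filtermap (\<lambda>n. 2 * n) sequentially)"
    unfolding eventually_filtermap eventually_sequentially by (intro exI[of _ N\<^sub>0]) auto
qed

lemma weakly_converges_even_at_top:
  "weakly_converges M L even_at_top \<longleftrightarrow> weakly_converges (\<lambda>n. M (2 * n)) L sequentially"
  by (simp add: weakly_converges_def even_at_top_eq filterlim_filtermap)


theorem theorem2p1:
  fixes \<beta> :: real and \<alpha> :: "nat \<Rightarrow> real"
  assumes "\<beta> > 2"
    and "\<And>N. even N \<Longrightarrow> 0 < N \<Longrightarrow> \<alpha> N > 0"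
    and "antimono_on {N. even N \<and> 0 < N} \<alpha>"
    and "(\<alpha> \<longlongrightarrow> 0) even_at_top"
  defines "mp \<equiv> m_plus (\<beta> / 2)" and "mm \<equiv> m_minus (\<beta> / 2)"
  shows "(filterlim (\<lambda>N. real N * \<alpha> N) at_top even_at_top \<longrightarrow>
            weakly_converges (\<lambda>N. magnetization_law N (\<alpha> N) \<beta>)
              (scale_measure (1 / 2) (dirac (mp, mp) +\<^sub>M dirac (mm, mm)))
              even_at_top) \<and>
         (((\<lambda>N. real N * \<alpha> N) \<longlongrightarrow> 0) even_at_top \<longrightarrow>
            weakly_converges (\<lambda>N. magnetization_law N (\<alpha> N) \<beta>)
              (scale_measure (1 / 4)
                (dirac (mp, mp) +\<^sub>M dirac (mp, mm) +\<^sub>M dirac (mm, mp) +\<^sub>M dirac (mm, mm)))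
              even_at_top)"
proof (intro conjI impI)
  define \<gamma> where "\<gamma> = \<beta> / 2"
  have \<gamma>: "\<gamma> > 1" and \<beta>: "\<beta> = 2 * \<gamma>" using assms(1) by (simp_all add: \<gamma>_def)
  define a where "a = (\<lambda>n. \<alpha> (2 * n))"
  have a0: "a \<longlonglongrightarrow> 0" using assms(4) by (simp add: a_def even_at_top_eq filterlim_filtermap)
  have a_nonneg: "a n \<ge> 0" if "n > 0" for n using assms(2)[of "2 * n"] that by (simp add: a_def)
  have mp_pos: "mp > 0" unfolding mp_def using mean_field_equation_unimodal(1)[OF \<gamma>] by (simp add: \<gamma>_def)
  have mp: "m_plus \<gamma> = mp" and mm: "mm = - mp" by (simp_all add: mp_def mm_def m_minus_def \<gamma>_def)
  let ?P = "\<lambda>n. magnetization_law (2 * n) (a n) (2 * \<gamma>)"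
  have P: "prob_space (?P n)" "sets (?P n) = sets borel" for n
    by (rule prob_space_magnetization_law, simp add: magnetization_law_def)
  show "weakly_converges (\<lambda>N. magnetization_law N (\<alpha> N) \<beta>)
      (scale_measure (1 / 2) (dirac (mp, mp) +\<^sub>M dirac (mm, mm))) even_at_top"
    if "filterlim (\<lambda>N. real N * \<alpha> N) at_top even_at_top"
  proof -
    let ?L = "scale_measure (1 / 2) (dirac (mp, mp) +\<^sub>M dirac (- mp, - mp))"
    let ?C = "{(mp, mp), (- mp, - mp)}"
    have L: "measure ?L A = (indicator A (mp, mp) + indicator A (- mp, - mp)) / 2" if "A \<in> sets borel" for A
      by (rule measure_eq_emeasure_eq_ennreal[OF _ emeasure_two_diracs[OF that]]) simp
    have "emeasure ?L UNIV = 1" by (subst emeasure_two_diracs) simp_all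
    moreover have "space ?L = UNIV" by (simp add: space_scale_measure)
    ultimately have L_prob: "prob_space ?L" by (intro prob_spaceI) (simp only:)
    have na: "filterlim (\<lambda>n. real n * a n) at_top sequentially"
    proof -
      have "filterlim (\<lambda>n. 2 * (real n * a n)) at_top sequentially"
        using that by (simp add: a_def even_at_top_eq filterlim_filtermap mult.assoc)
      from filterlim_tendsto_pos_mult_at_top[OF tendsto_const _ this, of "1 / 2"] show ?thesis by simp
    qed
    \<comment> \<open>The strong-coupling limit is available for radii up to half the distance from a corner to the axes.\<close>
    have "weakly_converges ?P ?L sequentially"
    proof (rule weakly_converges_finite_support[OF P L_prob, where C = ?C and \<epsilon>\<^sub>0 = "mp / 2"])
      show "disjoint_family_on (\<lambda>c. ball c (mp / 2)) ?C"
        by (rule disjoint_family_on_ball_mono[OF disjoint_family_on_mono[OF _ corners_disjoint[of mp]]])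
          (use mp_pos in \<open>auto simp: corners_def\<close>)
      show "measure ?L ?C = 1" using mp_pos by (subst L) auto
      fix c \<epsilon> assume c: "c \<in> ?C" and \<epsilon>: "0 < \<epsilon>" "\<epsilon> < mp / 2"
      have "measure (?P n) (ball c \<epsilon>) = measure (?P n) (ball (mp, mp) \<epsilon>)" for n
        using c measure_law_ball_minus[of n "a n" \<gamma> "(mp, mp)" \<epsilon>] by (elim insertE) simp_all
      moreover have ind: "indicat_real (ball c \<epsilon>) x = of_bool (x = c)" if "x \<in> corners mp" for x
        using c that \<epsilon> by (intro indicator_ball_corner) (auto simp: corners_def)
      then have "measure ?L (ball c \<epsilon>) = 1 / 2"
        unfolding L[OF borel_open[OF open_ball]] ind[OF corner_mem(1)] ind[OF corner_mem(2)]
          ind[OF corner_mem(3)] ind[OF corner_mem(4)]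
        using c mp_pos by (elim insertE SigmaE emptyE) simp_all
      moreover have "(\<lambda>n. measure (?P n) (ball (mp, mp) \<epsilon>)) \<longlonglongrightarrow> 1 / 2"
        using corner_probabilities_strong_coupling[OF \<gamma> a0 a_nonneg na] \<epsilon> by (simp add: mp)
      ultimately show "(\<lambda>n. measure (?P n) (ball c \<epsilon>)) \<longlonglongrightarrow> measure ?L (ball c \<epsilon>)" by (simp only:)
    qed (use mp_pos in auto)
    then show ?thesis by (simp add: weakly_converges_even_at_top a_def \<beta> mm)
  qed
  show "weakly_converges (\<lambda>N. magnetization_law N (\<alpha> N) \<beta>)
      (scale_measure (1 / 4)
        (dirac (mp, mp) +\<^sub>M dirac (mp, mm) +\<^sub>M dirac (mm, mp) +\<^sub>M dirac (mm, mm))) even_at_top"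
    if "((\<lambda>N. real N * \<alpha> N) \<longlongrightarrow> 0) even_at_top"
  proof -
    let ?L = "scale_measure (1 / 4)
        (dirac (mp, mp) +\<^sub>M dirac (mp, - mp) +\<^sub>M dirac (- mp, mp) +\<^sub>M dirac (- mp, - mp))"
    have L: "measure ?L A = (indicator A (mp, mp) + indicator A (mp, - mp) +
        indicator A (- mp, mp) + indicator A (- mp, - mp)) / 4" if "A \<in> sets borel" for A
      by (rule measure_eq_emeasure_eq_ennreal[OF _ emeasure_four_diracs[OF that]]) simp
    have "emeasure ?L UNIV = 1" by (subst emeasure_four_diracs) simp_all
    moreover have "space ?L = UNIV" by (simp add: space_scale_measure)
    ultimately have L_prob: "prob_space ?L" by (intro prob_spaceI) (simp only:)
    have na: "(\<lambda>n. real n * a n) \<longlonglongrightarrow> 0"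
    proof -
      have "(\<lambda>n. 2 * (real n * a n)) \<longlonglongrightarrow> 0"
        using that by (simp add: a_def even_at_top_eq filterlim_filtermap mult.assoc)
      from tendsto_mult[OF tendsto_const this, of "1 / 2"] show ?thesis by simp
    qed
    have "weakly_converges ?P ?L sequentially"
    proof (rule weakly_converges_finite_support[OF P L_prob, where C = "corners mp" and \<epsilon>\<^sub>0 = mp])
      show "disjoint_family_on (\<lambda>c. ball c mp) (corners mp)" by (rule corners_disjoint)
      show "measure ?L (corners mp) = 1"
        by (subst L) (auto simp: corners_def intro!: borel_closed finite_imp_closed)
      fix c \<epsilon> assume c: "c \<in> corners mp" and \<epsilon>: "0 < \<epsilon>" "\<epsilon> < mp"
      have flips: "measure (?P n) (ball (- mp, - mp) \<epsilon>) = measure (?P n) (ball (mp, mp) \<epsilon>)"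
        "measure (?P n) (ball (- mp, mp) \<epsilon>) = measure (?P n) (ball (mp, - mp) \<epsilon>)" for n
        using measure_law_ball_minus[of n "a n" \<gamma> "(mp, mp)" \<epsilon>]
          measure_law_ball_minus[of n "a n" \<gamma> "(mp, - mp)" \<epsilon>] by simp_all
      note limits = corner_probabilities_weak_coupling[OF \<gamma> na a0, of \<epsilon>, unfolded mp, OF \<epsilon>(1) less_imp_le[OF \<epsilon>(2)]]
      have "(\<lambda>n. measure (?P n) (ball c \<epsilon>)) \<longlonglongrightarrow> 1 / 4"
        using c unfolding corners_def by (elim insertE SigmaE emptyE) (simp_all add: limits flips)
      moreover have ind: "indicat_real (ball c \<epsilon>) x = of_bool (x = c)" if "x \<in> corners mp" for x
        using c that \<epsilon> by (intro indicator_ball_corner) auto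
      then have "measure ?L (ball c \<epsilon>) = 1 / 4"
        unfolding L[OF borel_open[OF open_ball]] ind[OF corner_mem(1)] ind[OF corner_mem(2)]
          ind[OF corner_mem(3)] ind[OF corner_mem(4)]
        using c[unfolded corners_def] mp_pos by (elim insertE SigmaE emptyE) simp_all
      ultimately show "(\<lambda>n. measure (?P n) (ball c \<epsilon>)) \<longlonglongrightarrow> measure ?L (ball c \<epsilon>)" by (simp only:)
    qed (use mp_pos in \<open>auto simp: corners_def\<close>)
    then show ?thesis by (simp add: weakly_converges_even_at_top a_def \<beta> mm)
  qed
qed

end
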